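(* Let $\mathcal{MV}^{\mathrm{ss}}$ be the category of semisimple MV-algebras and $\mathcal{MV}^{\mathrm{lcc}}$ its full subcategory of limit cut complete MV-algebras. For every semisimple MV-algebra $A$, $A^{\mathrm{lcc}}$ is limit cut complete, and the assignment $A\mapsto A^{\mathrm{lcc}}$ extends to a faithful functor $\mathcal{MV}^{\mathrm{ss}}\to\mathcal{MV}^{\mathrm{lcc}}$ which is left adjoint to the inclusion functor $\mathcal{MV}^{\mathrm{lcc}}\hookrightarrow\mathcal{MV}^{\mathrm{ss}}$; i.e., $\mathcal{MV}^{\mathrm{lcc}}$ is a reflective subcategory of $\mathcal{MV}^{\mathrm{ss}}$ with faithful reflector $A\mapsto A^{\mathrm{lcc}}$.
   Context: MV-algebras of fuzzy subsets: for a set $X$, $[0,1]^X$ carries pointwise operations $x\oplus y=\min(1,x+y)$, $x^*=1-x$, $x\odot y=\max(0,x+y-1)$ and pointwise order. For an MV-algebra $A$, $\mathrm{Max}A$ is its set of maximal ideals; each $A/M$ embeds uniquely into $[0,1]$ via $\iota_M$; $\widehat a(M)=\iota_M(a/M)$ defines $\widehat a\in[0,1]^{\mathrm{Max}A}$, and $a\mapsto\widehat a$ is a homomorphism, injective iff $A$ is semisimple (intersection of maximal ideals is $\{0\}$); $\widehat A$ is its image. For a semisimple $A$ and $Z\subseteq A$, $uZ,lZ$ are the sets of upper and lower bounds of $Z$ in $A$; $Z$ is a cut if $Z=luZ$, and a limit cut if $\bigwedge\{\widehat b\odot(\widehat a)^*: b\in uZ,\ a\in Z\}=\mathbf 0$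 in $[0,1]^{\mathrm{Max}A}$. $A$ is limit cut complete if every limit cut of $A$ has a supremum in $A$. For a semisimple $A$, $A^{\mathrm{lcc}}$ is the intersection of all MV-subalgebras $B$ of $[0,1]^{\mathrm{Max}A}$ that are limit cut complete and contain $\widehat A$. *)

theory Defs
  imports Complex_Main "HOL-Library.FuncSet" "HOL-Algebra.Order"
begin

section \<open>MV-algebras\<close>

record 'a mv = "'a partial_object" +
  mv_plus :: "'a \<Rightarrow> 'a \<Rightarrow> 'a" (infixl \<open>\<oplus>\<index>\<close> 65)
  mv_neg :: "'a \<Rightarrow> 'a" (\<open>\<sim>\<index> _\<close> [81] 80)
  mv_zero :: 'a (\<open>\<zero>\<index>\<close>)

text \<open>The one-element MV-algebra is not excluded.\<close>

locale mv_algebra =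
  fixes A :: "'a mv" (structure)
  assumes plus_closed: "\<lbrakk>x \<in> carrier A; y \<in> carrier A\<rbrakk> \<Longrightarrow> x \<oplus> y \<in> carrier A"
    and neg_closed: "x \<in> carrier A \<Longrightarrow> \<sim> x \<in> carrier A"
    and zero_closed: "\<zero> \<in> carrier A"
    and plus_assoc: "\<lbrakk>x \<in> carrier A; y \<in> carrier A; z \<in> carrier A\<rbrakk> \<Longrightarrow> (x \<oplus> y) \<oplus> z = x \<oplus> (y \<oplus> z)"
    and plus_comm: "\<lbrakk>x \<in> carrier A; y \<in> carrier A\<rbrakk> \<Longrightarrow> x \<oplus> y = y \<oplus> x"
    and plus_zero: "x \<in> carrier A \<Longrightarrow> x \<oplus> \<zero> = x"
    and neg_neg: "x \<in> carrier A \<Longrightarrow> \<sim> (\<sim> x) = x"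
    and plus_one: "x \<in> carrier A \<Longrightarrow> x \<oplus> \<sim> \<zero> = \<sim> \<zero>"
    and lukasiewicz: "\<lbrakk>x \<in> carrier A; y \<in> carrier A\<rbrakk> \<Longrightarrow> \<sim> (\<sim> x \<oplus> y) \<oplus> y = \<sim> (\<sim> y \<oplus> x) \<oplus> x"

definition mv_times :: "'a mv \<Rightarrow> 'a \<Rightarrow> 'a \<Rightarrow> 'a" (infixl \<open>\<odot>\<index>\<close> 70)
  where "x \<odot>\<^bsub>A\<^esub> y = \<sim>\<^bsub>A\<^esub> (\<sim>\<^bsub>A\<^esub> x \<oplus>\<^bsub>A\<^esub> \<sim>\<^bsub>A\<^esub> y)"

definition mv_order :: "'a mv \<Rightarrow> 'a gorder"
  where "mv_order A = \<lparr>carrier = carrier A, eq = (=), le = (\<lambda>x y. \<sim>\<^bsub>A\<^esub> x \<oplus>\<^bsub>A\<^esub> y = \<sim>\<^bsub>A\<^esub> \<zero>\<^bsub>A\<^esub>)\<rparr>"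

definition mv_subalgebra :: "'a set \<Rightarrow> 'a mv \<Rightarrow> bool"
  where "mv_subalgebra S A \<longleftrightarrow> S \<subseteq> carrier A \<and> \<zero>\<^bsub>A\<^esub> \<in> S \<and>
    (\<forall>x\<in>S. \<sim>\<^bsub>A\<^esub> x \<in> S) \<and> (\<forall>x\<in>S. \<forall>y\<in>S. x \<oplus>\<^bsub>A\<^esub> y \<in> S)"

definition mv_restrict :: "'a mv \<Rightarrow> 'a set \<Rightarrow> 'a mv"
  where "mv_restrict A S = A\<lparr>carrier := S\<rparr>"

text \<open>Homomorphisms are extensional functions, so that equality of morphisms is equality in HOL.\<close>

definition mv_hom :: "'a mv \<Rightarrow> 'b mv \<Rightarrow> ('a \<Rightarrow> 'b) set"
  where "mv_hom A B = {f \<in> carrier A \<rightarrow>\<^sub>E carrier B. f \<zero>\<^bsub>A\<^esub> = \<zero>\<^bsub>B\<^esub> \<and>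
    (\<forall>x\<in>carrier A. f (\<sim>\<^bsub>A\<^esub> x) = \<sim>\<^bsub>B\<^esub> (f x)) \<and>
    (\<forall>x\<in>carrier A. \<forall>y\<in>carrier A. f (x \<oplus>\<^bsub>A\<^esub> y) = f x \<oplus>\<^bsub>B\<^esub> f y)}"

definition mv_id :: "'a mv \<Rightarrow> 'a \<Rightarrow> 'a"
  where "mv_id A = (\<lambda>x\<in>carrier A. x)"

section \<open>Fuzzy subsets\<close>

definition unit_mv :: "real mv"
  where "unit_mv = \<lparr>carrier = {0..1}, mv_plus = (\<lambda>x y. min 1 (x + y)), mv_neg = (\<lambda>x. 1 - x), mv_zero = 0\<rparr>"

definition fuzzy :: "'x set \<Rightarrow> ('x \<Rightarrow> real) mv"
  where "fuzzy X = \<lparr>carrier = X \<rightarrow>\<^sub>E {0..1},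
    mv_plus = (\<lambda>p q. \<lambda>x\<in>X. min 1 (p x + q x)),
    mv_neg = (\<lambda>p. \<lambda>x\<in>X. 1 - p x),
    mv_zero = (\<lambda>x\<in>X. 0)\<rparr>"

section \<open>Maximal ideals and the representation by fuzzy subsets\<close>

definition mv_ideal :: "'a set \<Rightarrow> 'a mv \<Rightarrow> bool"
  where "mv_ideal I A \<longleftrightarrow> I \<subseteq> carrier A \<and> \<zero>\<^bsub>A\<^esub> \<in> I \<and> (\<forall>x\<in>I. \<forall>y\<in>I. x \<oplus>\<^bsub>A\<^esub> y \<in> I) \<and>
    (\<forall>x\<in>I. \<forall>y\<in>carrier A. y \<sqsubseteq>\<^bsub>mv_order A\<^esub> x \<longrightarrow> y \<in> I)"

definition MaxI :: "'a mv \<Rightarrow> 'a set set"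
  where "MaxI A = {M. mv_ideal M A \<and> M \<noteq> carrier A \<and>
    (\<forall>I. mv_ideal I A \<longrightarrow> M \<subseteq> I \<longrightarrow> I = M \<or> I = carrier A)}"

text \<open>The empty intersection is \<open>carrier A\<close>: the one-element MV-algebra has no maximal ideals
  and is semisimple.\<close>

definition semisimple :: "'a mv \<Rightarrow> bool"
  where "semisimple A \<longleftrightarrow> mv_algebra A \<and> carrier A \<inter> \<Inter>(MaxI A) = {\<zero>\<^bsub>A\<^esub>}"

definition mv_cong :: "'a mv \<Rightarrow> 'a set \<Rightarrow> ('a \<times> 'a) set"
  where "mv_cong A I = {(x, y). x \<in> carrier A \<and> y \<in> carrier A \<and>
    (x \<odot>\<^bsub>A\<^esub> \<sim>\<^bsub>A\<^esub> y) \<oplus>\<^bsub>A\<^esub> (y \<odot>\<^bsub>A\<^esub> \<sim>\<^bsub>A\<^esub> x) \<in> I}"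

definition mv_quot :: "'a mv \<Rightarrow> 'a set \<Rightarrow> 'a set mv"
  where "mv_quot A I = \<lparr>carrier = carrier A // mv_cong A I,
    mv_plus = (\<lambda>X Y. \<Union>x\<in>X. \<Union>y\<in>Y. mv_cong A I `` {x \<oplus>\<^bsub>A\<^esub> y}),
    mv_neg = (\<lambda>X. \<Union>x\<in>X. mv_cong A I `` {\<sim>\<^bsub>A\<^esub> x}),
    mv_zero = mv_cong A I `` {\<zero>\<^bsub>A\<^esub>}\<rparr>"

definition mv_iota :: "'a mv \<Rightarrow> 'a set \<Rightarrow> 'a set \<Rightarrow> real"
  where "mv_iota A M = (THE h. h \<in> mv_hom (mv_quot A M) unit_mv \<and> inj_on h (carrier (mv_quot A M)))"

definition mv_hat :: "'a mv \<Rightarrow> 'a \<Rightarrow> ('a set \<Rightarrow> real)"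
  where "mv_hat A = (\<lambda>a\<in>carrier A. \<lambda>M\<in>MaxI A. mv_iota A M (mv_cong A M `` {a}))"

section \<open>Limit cuts\<close>

definition mv_cut :: "'a mv \<Rightarrow> 'a set \<Rightarrow> bool"
  where "mv_cut A Z \<longleftrightarrow> Z \<subseteq> carrier A \<and> Z = Lower (mv_order A) (Upper (mv_order A) Z)"

definition limit_cut :: "'a mv \<Rightarrow> 'a set \<Rightarrow> bool"
  where "limit_cut A Z \<longleftrightarrow> mv_cut A Z \<and>
    (let F = fuzzy (MaxI A) in
      greatest (mv_order F) \<zero>\<^bsub>F\<^esub> (Lower (mv_order F)
        {mv_hat A b \<odot>\<^bsub>F\<^esub> \<sim>\<^bsub>F\<^esub> (mv_hat A a) | b a. b \<in> Upper (mv_order A) Z \<and> a \<in> Z}))"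

definition limit_cut_complete :: "'a mv \<Rightarrow> bool"
  where "limit_cut_complete A \<longleftrightarrow> semisimple A \<and>
    (\<forall>Z. limit_cut A Z \<longrightarrow> (\<exists>s. least (mv_order A) s (Upper (mv_order A) Z)))"

definition lcc :: "'a mv \<Rightarrow> ('a set \<Rightarrow> real) mv"
  where "lcc A = mv_restrict (fuzzy (MaxI A))
    (\<Inter>{S. mv_subalgebra S (fuzzy (MaxI A)) \<and> limit_cut_complete (mv_restrict (fuzzy (MaxI A)) S) \<and>
         mv_hat A ` carrier A \<subseteq> S})"

section \<open>The categories and the functor\<close>

text \<open>
  \<open>MVss\<close> and \<open>MVlcc\<close> are the object classes; in both categories the morphisms from \<open>A\<close> to \<open>B\<close>
  are \<open>mv_hom A B\<close>, the identities are \<open>mv_id A\<close>, and the composite of \<open>f\<close> from \<open>A\<close> with \<open>g\<close> is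
  \<open>compose (carrier A) g f\<close>. Objects and morphisms range over all carrier types: the carrier type
  of \<open>lcc A\<close> differs from that of \<open>A\<close>, so the functor and the adjunction relate objects over
  different types.\<close>

definition MVss :: "'a mv set"
  where "MVss = {A. semisimple A}"

definition MVlcc :: "'a mv set"
  where "MVlcc = {A. limit_cut_complete A}"

text \<open>The inverse image along a homomorphism maps \<open>MaxI B\<close> to \<open>MaxI A\<close>; the functor acts on
  morphisms by precomposition with this map.\<close>

definition lcc_map :: "'a mv \<Rightarrow> 'b mv \<Rightarrow> ('a \<Rightarrow> 'b) \<Rightarrow> ('a set \<Rightarrow> real) \<Rightarrow> ('b set \<Rightarrow> real)"
  where "lcc_map A B f = (\<lambda>p\<in>carrier (lcc A). \<lambda>N\<in>MaxI B. p (f -` N \<inter> carrier A))"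

text \<open>The adjunction on hom-sets: precomposition with the unit \<open>mv_hat A\<close>.\<close>

definition lcc_adj :: "'a mv \<Rightarrow> (('a set \<Rightarrow> real) \<Rightarrow> 'c) \<Rightarrow> ('a \<Rightarrow> 'c)"
  where "lcc_adj A h = compose (carrier A) h (mv_hat A)"

section \<open>Consistency of the encodings\<close>

lemma unit_mv_algebra: "mv_algebra unit_mv"
  by unfold_locales (auto simp: unit_mv_def min_def)

lemma fuzzy_mv_algebra: "mv_algebra (fuzzy X)"
proof
  fix x y z assume "x \<in> carrier (fuzzy X)" "y \<in> carrier (fuzzy X)" "z \<in> carrier (fuzzy X)"
  then have "\<And>t. t \<in> X \<Longrightarrow> 0 \<le> x t \<and> 0 \<le> y t \<and> 0 \<le> z t"
    by (auto simp: fuzzy_def PiE_iff)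
  then show "x \<oplus>\<^bsub>fuzzy X\<^esub> y \<oplus>\<^bsub>fuzzy X\<^esub> z = x \<oplus>\<^bsub>fuzzy X\<^esub> (y \<oplus>\<^bsub>fuzzy X\<^esub> z)"
    by (force simp: fuzzy_def min_def restrict_def)
next
  fix x assume "x \<in> carrier (fuzzy X)"
  then have x: "x \<in> extensional X" "\<And>t. t \<in> X \<Longrightarrow> 0 \<le> x t \<and> x t \<le> 1"
    by (auto simp: fuzzy_def PiE_iff)
  show "x \<oplus>\<^bsub>fuzzy X\<^esub> \<zero>\<^bsub>fuzzy X\<^esub> = x" "\<sim>\<^bsub>fuzzy X\<^esub> (\<sim>\<^bsub>fuzzy X\<^esub> x) = x"
    using x by (auto simp: fuzzy_def fun_eq_iff restrict_def extensional_def)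
  show "x \<oplus>\<^bsub>fuzzy X\<^esub> \<sim>\<^bsub>fuzzy X\<^esub> \<zero>\<^bsub>fuzzy X\<^esub> = \<sim>\<^bsub>fuzzy X\<^esub> \<zero>\<^bsub>fuzzy X\<^esub>"
    using x by (auto simp: fuzzy_def fun_eq_iff restrict_def)
qed (auto simp: fuzzy_def PiE_iff fun_eq_iff restrict_def min_def extensional_def)

lemma fuzzy_times:
  assumes "p \<in> carrier (fuzzy X)" "q \<in> carrier (fuzzy X)"
  shows "p \<odot>\<^bsub>fuzzy X\<^esub> q = (\<lambda>x\<in>X. max 0 (p x + q x - 1))"
  by (auto simp: mv_times_def fuzzy_def restrict_def fun_eq_iff)

lemma fuzzy_le:
  assumes "p \<in> carrier (fuzzy X)" "q \<in> carrier (fuzzy X)"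
  shows "p \<sqsubseteq>\<^bsub>mv_order (fuzzy X)\<^esub> q \<longleftrightarrow> (\<forall>x\<in>X. p x \<le> q x)"
  by (auto simp: mv_order_def fuzzy_def restrict_def fun_eq_iff min_def; smt (verit))

lemma mv_id_hom: "mv_algebra A \<Longrightarrow> mv_id A \<in> mv_hom A A"
  by (auto simp: mv_id_def mv_hom_def mv_algebra_def)

lemma mv_compose_hom:
  assumes "mv_algebra A" "f \<in> mv_hom A B" "g \<in> mv_hom B C"
  shows "compose (carrier A) g f \<in> mv_hom A C"
proof -
  interpret mv_algebra A by fact
  show ?thesis
    using assms(2,3) by (auto simp: mv_hom_def compose_def PiE_iff plus_closed neg_closed zero_closed)
qed

end

theory Submission
  imports Defs
begin

text \<open>
  Hoelder's theorem embeds the simple MV-chain \<open>A/M\<close> into the unit interval by reading off binary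
  digits: doubling \<open>x\<close> gives \<open>x \<oplus> x\<close> when \<open>x \<odot> x = 0\<close> and \<open>x \<odot> x\<close> otherwise, and the distinction
  is the next digit. The same doubling shows that a homomorphism into the unit interval is
  determined by its kernel, so these homomorphisms correspond to the maximal ideals of \<open>A\<close>.

  The limit cut completion consists of the functions on \<open>MaxI A\<close> that can be squeezed, up to
  \<open>\<epsilon>\<close> at any prescribed point, between two elements \<open>mv_hat A a \<le> mv_hat A b\<close>: such a function is
  the supremum of the limit cut of its lower approximations, and pointwise suprema of limit cuts of
  squeezed functions are squeezed. A homomorphism from the completion to the unit interval is
  monotone and agrees on \<open>A\<close> with the evaluation at some maximal ideal, hence is that evaluation
  everywhere. This gives functoriality, faithfulness and the universal property.\<close>

section \<open>Arithmetic of MV-algebras\<close>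

text \<open>\<open>mv_iota\<close> is a definite description, so the embedding of \<open>A/M\<close>
  has to be shown to exist and to be unique before \<open>mv_hat\<close> can be computed at all. The
  usual argument for Hoelder's theorem takes place in an ordered group, where sums are not
  truncated; digits keep everything inside the algebra. The price is that every carry must be
  justified by laws for \<open>\<oplus>\<close> and \<open>\<odot>\<close> alone, and limits enter
  through one principle only: a bounded error that is at most half the error at some other argument
  is never positive. The obstacle in the completion is that a limit cut complete subalgebra
  \<open>S\<close> of \<open>fuzzy (MaxI A)\<close> containing the image of \<open>A\<close> may
  have maximal ideals that are not evaluations at points of \<open>MaxI A\<close>, whereas a limit
  cut of \<open>S\<close> is tested at all of them. Taking the two bounds of a squeezed function
  from the image of \<open>A\<close> removes this obstacle: on that image every maximal ideal of
  \<open>S\<close> acts as a point of \<open>MaxI A\<close>.\<close>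

context mv_algebra
begin

definition le :: "'a \<Rightarrow> 'a \<Rightarrow> bool" (infix \<open>\<preceq>\<close> 50)
  where "x \<preceq> y \<longleftrightarrow> \<sim> x \<oplus> y = \<sim> \<zero>"

definition diff :: "'a \<Rightarrow> 'a \<Rightarrow> 'a" (infixl \<open>\<ominus>\<close> 65)
  where "x \<ominus> y = x \<odot> \<sim> y"

lemma le_iff: "x \<sqsubseteq>\<^bsub>mv_order A\<^esub> y \<longleftrightarrow> x \<preceq> y"
  by (simp add: mv_order_def le_def)

lemma diff_eq: "y \<in> carrier A \<Longrightarrow> x \<ominus> y = \<sim> (\<sim> x \<oplus> y)"
  by (simp add: diff_def mv_times_def neg_neg)

lemma times_closed: "x \<in> carrier A \<Longrightarrow> y \<in> carrier A \<Longrightarrow> x \<odot> y \<in> carrier A"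
  by (simp add: mv_times_def plus_closed neg_closed)

lemma diff_closed: "x \<in> carrier A \<Longrightarrow> y \<in> carrier A \<Longrightarrow> x \<ominus> y \<in> carrier A"
  by (simp add: diff_def times_closed neg_closed)

lemmas closed [simp, intro] = plus_closed neg_closed zero_closed times_closed diff_closed

declare neg_neg [simp] plus_zero [simp] plus_one [simp]

lemma zero_plus [simp]: "x \<in> carrier A \<Longrightarrow> \<zero> \<oplus> x = x"
  using plus_comm[of x \<zero>] by simp

lemma one_plus [simp]: "x \<in> carrier A \<Longrightarrow> \<sim> \<zero> \<oplus> x = \<sim> \<zero>"
  using plus_comm[of x "\<sim> \<zero>"] by simp

lemma plus_lcomm:
  "\<lbrakk>x \<in> carrier A; y \<in> carrier A; z \<in> carrier A\<rbrakk> \<Longrightarrow> x \<oplus> (y \<oplus> z) = y \<oplus> (x \<oplus> z)"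
  by (metis plus_assoc plus_comm)

lemmas plus_ac = plus_assoc plus_comm plus_lcomm

lemma neg_eq_zero: "x \<in> carrier A \<Longrightarrow> \<sim> x = \<zero> \<longleftrightarrow> x = \<sim> \<zero>"
  by (metis neg_neg zero_closed)

lemma neg_plus_self [simp]: "x \<in> carrier A \<Longrightarrow> \<sim> x \<oplus> x = \<sim> \<zero>"
  using lukasiewicz[of x "\<sim> \<zero>"] by simp

lemma le_refl: "x \<in> carrier A \<Longrightarrow> x \<preceq> x"
  by (simp add: le_def)

lemma le_plus: "\<lbrakk>x \<in> carrier A; z \<in> carrier A\<rbrakk> \<Longrightarrow> x \<preceq> x \<oplus> z"
  by (simp add: le_def plus_assoc[symmetric])

lemma zero_le: "x \<in> carrier A \<Longrightarrow> \<zero> \<preceq> x"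
  by (simp add: le_def)

lemma le_one: "x \<in> carrier A \<Longrightarrow> x \<preceq> \<sim> \<zero>"
  by (simp add: le_def)

text \<open>Both sides of \<open>lukasiewicz\<close> are the join of \<open>x\<close> and
  \<open>y\<close>; when \<open>x \<preceq> y\<close> one of them collapses to \<open>y\<close>.
  Inequalities thereby become sums, which is how transitivity and monotonicity are proved.\<close>

lemma plus_diff: "\<lbrakk>x \<in> carrier A; y \<in> carrier A; x \<preceq> y\<rbrakk> \<Longrightarrow> x \<oplus> (y \<ominus> x) = y"
  using lukasiewicz[of x y] by (simp add: le_def diff_eq plus_comm)

lemma le_antisym: "\<lbrakk>x \<in> carrier A; y \<in> carrier A; x \<preceq> y; y \<preceq> x\<rbrakk> \<Longrightarrow> x = y"
  using plus_diff[of x y] by (simp add: le_def diff_eq)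

lemma le_trans:
  assumes "x \<in> carrier A" "y \<in> carrier A" "z \<in> carrier A" "x \<preceq> y" "y \<preceq> z"
  shows "x \<preceq> z"
proof -
  have "z = x \<oplus> ((y \<ominus> x) \<oplus> (z \<ominus> y))"
    using assms by (simp add: plus_assoc[symmetric] plus_diff)
  then show ?thesis
    using assms le_plus by (metis closed(1,5))
qed

lemma plus_mono:
  assumes "x \<in> carrier A" "y \<in> carrier A" "z \<in> carrier A" "w \<in> carrier A" "x \<preceq> y" "z \<preceq> w"
  shows "x \<oplus> z \<preceq> y \<oplus> w"
proof -
  have "y \<oplus> w = (x \<oplus> (y \<ominus> x)) \<oplus> (z \<oplus> (w \<ominus> z))"
    using assms by (simp add: plus_diff)
  also have "\<dots> = (x \<oplus> z) \<oplus> ((y \<ominus> x) \<oplus> (w \<ominus> z))"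
    using assms(1-4) by (simp add: plus_ac)
  finally show ?thesis
    using assms(1-4) le_plus by (metis closed(1,5))
qed

lemma diff_le_iff:
  "\<lbrakk>x \<in> carrier A; y \<in> carrier A; z \<in> carrier A\<rbrakk> \<Longrightarrow> x \<ominus> y \<preceq> z \<longleftrightarrow> x \<preceq> y \<oplus> z"
  by (simp add: le_def diff_eq plus_assoc)

lemma le_plus_diff: "\<lbrakk>x \<in> carrier A; y \<in> carrier A\<rbrakk> \<Longrightarrow> x \<preceq> y \<oplus> (x \<ominus> y)"
  by (simp add: diff_le_iff[symmetric] le_refl)

lemma diff_diff:
  "\<lbrakk>x \<in> carrier A; y \<in> carrier A; z \<in> carrier A\<rbrakk> \<Longrightarrow> x \<ominus> y \<ominus> z = x \<ominus> (y \<oplus> z)"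
  by (simp add: diff_eq plus_assoc)

lemma le_zero_iff: "x \<in> carrier A \<Longrightarrow> x \<preceq> \<zero> \<longleftrightarrow> x = \<zero>"
  using le_antisym zero_le le_refl by blast

lemma diff_eq_zero: "\<lbrakk>x \<in> carrier A; y \<in> carrier A\<rbrakk> \<Longrightarrow> x \<ominus> y = \<zero> \<longleftrightarrow> x \<preceq> y"
  by (simp add: diff_eq neg_eq_zero le_def)

lemma diff_le: "\<lbrakk>x \<in> carrier A; y \<in> carrier A\<rbrakk> \<Longrightarrow> x \<ominus> y \<preceq> x"
  by (simp add: diff_le_iff plus_comm le_plus)

lemma le_neg_iff: "\<lbrakk>x \<in> carrier A; y \<in> carrier A\<rbrakk> \<Longrightarrow> x \<preceq> \<sim> y \<longleftrightarrow> x \<odot> y = \<zero>"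
  by (simp add: le_def mv_times_def neg_eq_zero)

lemma times_comm: "\<lbrakk>x \<in> carrier A; y \<in> carrier A\<rbrakk> \<Longrightarrow> x \<odot> y = y \<odot> x"
  by (simp add: mv_times_def plus_comm)

lemma times_assoc:
  "\<lbrakk>x \<in> carrier A; y \<in> carrier A; z \<in> carrier A\<rbrakk> \<Longrightarrow> x \<odot> y \<odot> z = x \<odot> (y \<odot> z)"
  by (simp add: mv_times_def plus_assoc)

lemma times_mono:
  assumes "x \<in> carrier A" "y \<in> carrier A" "z \<in> carrier A" "w \<in> carrier A" "x \<preceq> y" "z \<preceq> w"
  shows "x \<odot> z \<preceq> y \<odot> w"
proof -
  have "\<sim> y \<oplus> \<sim> w \<preceq> \<sim> x \<oplus> \<sim> z"
    using assms by (intro plus_mono) (simp_all add: le_def plus_comm)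
  then show ?thesis
    using assms by (simp add: mv_times_def le_def plus_comm)
qed

lemma zero_times: "x \<in> carrier A \<Longrightarrow> \<zero> \<odot> x = \<zero>"
  by (simp add: mv_times_def)

lemma plus_eq_one_iff: "\<lbrakk>x \<in> carrier A; y \<in> carrier A\<rbrakk> \<Longrightarrow> x \<oplus> y = \<sim> \<zero> \<longleftrightarrow> \<sim> x \<preceq> y"
  by (simp add: le_def)

section \<open>Truncated sums: cancellation, mixed associativity and prelinearity\<close>

lemma plus_diff_cancel:
  assumes "x \<in> carrier A" "y \<in> carrier A" "x \<odot> y = \<zero>"
  shows "(x \<oplus> y) \<ominus> x = y"
proof -
  have "\<sim> (x \<oplus> y) \<oplus> x = \<sim> (\<sim> x \<oplus> \<sim> y) \<oplus> \<sim> y"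
    using lukasiewicz[of "\<sim> y" x] assms by (simp add: plus_comm)
  also have "\<dots> = \<sim> y"
    using assms by (simp add: mv_times_def)
  finally show ?thesis
    using assms by (simp add: diff_eq)
qed

lemma times_diff: "\<lbrakk>x \<in> carrier A; y \<in> carrier A\<rbrakk> \<Longrightarrow> x \<odot> y = x \<ominus> \<sim> y"
  by (simp add: diff_def)

text \<open>In the unit interval both sides are the positive part of \<open>x + y + z - 1\<close>,
  because neither inner sum is truncated. This law and the next one do the regrouping for which an
  enveloping group would otherwise be used.\<close>

lemma times_plus_assoc:
  assumes c: "x \<in> carrier A" "y \<in> carrier A" "z \<in> carrier A" and "x \<odot> y = \<zero>" "y \<odot> z = \<zero>"
  shows "(x \<oplus> y) \<odot> z = x \<odot> (y \<oplus> z)"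
proof -
  have "(x \<oplus> y) \<odot> z = (x \<oplus> y) \<ominus> (y \<oplus> (\<sim> z \<ominus> y))"
    using assms by (simp add: plus_diff le_neg_iff times_diff[of _ z])
  also have "\<dots> = ((y \<oplus> x) \<ominus> y) \<ominus> (\<sim> z \<ominus> y)"
    using c by (simp add: diff_diff plus_comm)
  also have "\<dots> = x \<ominus> (\<sim> z \<ominus> y)"
    using assms times_comm[of x y] by (simp add: plus_diff_cancel)
  also have "\<dots> = x \<odot> (y \<oplus> z)"
    using c by (simp add: diff_eq mv_times_def plus_comm)
  finally show ?thesis .
qed

text \<open>In the unit interval both sides are \<open>x + y + z - 1\<close>, which lies between 0
  and 1 under these conditions.\<close>

lemma plus_times_assoc:
  assumes c: "x \<in> carrier A" "y \<in> carrier A" "z \<in> carrier A"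
    and xy: "x \<oplus> y = \<sim> \<zero>" and yz: "y \<odot> z = \<zero>"
  shows "(x \<odot> y) \<oplus> z = x \<odot> (y \<oplus> z)"
proof -
  have n: "\<sim> x \<odot> \<sim> y = \<zero>"
    using c xy by (simp add: mv_times_def neg_eq_zero)
  have m: "\<sim> y \<oplus> \<sim> z = \<sim> \<zero>"
    using c yz by (metis mv_times_def closed(1,2) neg_eq_zero)
  \<comment> \<open>\<open>?r\<close> is the slack of \<open>y \<oplus> z\<close> below one. The
    element \<open>x\<close> splits as \<open>z \<oplus> ?r \<oplus> ?p\<close>, and removing
    \<open>?r\<close> again leaves \<open>?p \<oplus> z\<close>.\<close>
  let ?p = "x \<odot> y" and ?r = "\<sim> (y \<oplus> z)"
  have y: "\<sim> y = z \<oplus> ?r"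
    using c yz plus_diff[of z "\<sim> y"] times_comm[of y z]
    by (simp add: le_neg_iff diff_eq)
  have "\<sim> y \<preceq> x"
    using c xy by (simp add: le_def plus_comm)
  then have x: "x = \<sim> y \<oplus> ?p"
    using c plus_diff[of "\<sim> y" x] by (simp add: diff_def)
  have "?p \<preceq> y"
    using c by (simp add: times_comm[of x] diff_le times_diff[of y])
  then have "?p \<oplus> z \<preceq> \<sim> ?r"
    using c by (simp add: plus_mono le_refl)
  then have "?r \<odot> (?p \<oplus> z) = \<zero>"
    using c le_neg_iff[of "?p \<oplus> z" ?r] times_comm[of ?r "?p \<oplus> z"] by simp
  then have "?p \<oplus> z = (?r \<oplus> (?p \<oplus> z)) \<ominus> ?r"
    using c by (simp add: plus_diff_cancel)
  also have "?r \<oplus> (?p \<oplus> z) = (z \<oplus> ?r) \<oplus> ?p"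
    using c by (simp add: plus_ac)
  also have "\<dots> = x"
    by (simp only: y[symmetric] x[symmetric])
  also have "x \<ominus> ?r = x \<odot> (y \<oplus> z)"
    using c by (simp add: diff_def)
  finally show ?thesis .
qed

text \<open>Prelinearity: the two differences have meet zero. The meet of \<open>u\<close> and
  \<open>w\<close> is \<open>u \<odot> (\<sim> u \<oplus> w)\<close>, which vanishes exactly when
  \<open>u \<preceq> u \<ominus> w\<close>. The absorption form can be iterated over multiples of
  \<open>y \<ominus> x\<close>.\<close>

lemma diff_diff_swap_eq:
  assumes c: "x \<in> carrier A" "y \<in> carrier A"
  shows "(x \<ominus> y) \<ominus> (y \<ominus> x) = x \<ominus> y"
proof -
  have meet: "a \<odot> (\<sim> a \<oplus> b) = b \<odot> (\<sim> b \<oplus> a)" if "a \<in> carrier A" "b \<in> carrier A" for a b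
  proof -
    have "\<sim> (\<sim> a \<oplus> b) = \<sim> (b \<oplus> \<sim> a)" "\<sim> (\<sim> b \<oplus> a) = \<sim> (a \<oplus> \<sim> b)"
      using that by (simp_all add: plus_comm)
    then show ?thesis
      using that lukasiewicz[of "\<sim> a" "\<sim> b"] by (simp add: mv_times_def plus_comm)
  qed
  have lower: "a \<odot> (\<sim> a \<oplus> b) \<preceq> b" if "a \<in> carrier A" "b \<in> carrier A" for a b
    using that diff_le[of b "\<sim> (\<sim> b \<oplus> a)"] by (simp add: meet[of a b] times_diff[of b])
  define u where "u = x \<ominus> y"
  define w where "w = y \<ominus> x"
  define p where "p = y \<oplus> w"
  have uw: "u \<in> carrier A" "w \<in> carrier A" "p \<in> carrier A"
    using c by (auto simp: u_def w_def p_def)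
  have times_lcomm: "a \<odot> (b \<odot> d) = b \<odot> (a \<odot> d)"
    if "a \<in> carrier A" "b \<in> carrier A" "d \<in> carrier A" for a b d
    using that by (metis times_assoc times_comm)
  \<comment> \<open>As \<open>\<sim> u\<close> is \<open>\<sim> x \<oplus> y\<close>, the sum
    \<open>\<sim> u \<oplus> w\<close> is \<open>\<sim> x \<oplus> p\<close>; this is where
    \<open>p\<close> comes from. Symmetry of the meet then regroups the product into
    \<open>y\<close> times an element below \<open>\<sim> p\<close>, hence below
    \<open>\<sim> y\<close>.\<close>
  have "u \<odot> (\<sim> u \<oplus> w) = \<sim> y \<odot> (x \<odot> (\<sim> x \<oplus> p))"
    using c uw by (simp add: u_def diff_def[of x] mv_times_def plus_ac p_def)
  also have "\<dots> = (\<sim> y \<odot> p) \<odot> (\<sim> p \<oplus> x)"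
    using c uw by (simp add: meet[of x p] times_assoc)
  also have "\<sim> y \<odot> p = w \<odot> (\<sim> w \<oplus> \<sim> y)"
    using c uw meet[of "\<sim> y" w] by (simp add: p_def)
  also have "\<dots> \<odot> (\<sim> p \<oplus> x) = (\<sim> w \<oplus> \<sim> y) \<odot> (y \<odot> (\<sim> x \<odot> (x \<oplus> \<sim> p)))"
    using c uw by (simp add: w_def diff_def[of y] times_assoc times_lcomm plus_comm)
  also have "\<dots> = \<zero>"
  proof -
    have "\<sim> x \<odot> (x \<oplus> \<sim> p) \<preceq> \<sim> p"
      using c uw lower[of "\<sim> x" "\<sim> p"] by simp
    moreover have "\<sim> p \<preceq> \<sim> y"
      using c uw le_plus[of y w] by (simp add: le_def p_def plus_comm)
    ultimately have "\<sim> x \<odot> (x \<oplus> \<sim> p) \<preceq> \<sim> y"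
      using c uw le_trans[of "\<sim> x \<odot> (x \<oplus> \<sim> p)" "\<sim> p" "\<sim> y"] by simp
    then have "y \<odot> (\<sim> x \<odot> (x \<oplus> \<sim> p)) = \<zero>"
      using c uw le_neg_iff[of "\<sim> x \<odot> (x \<oplus> \<sim> p)" y] times_comm[of y "\<sim> x \<odot> (x \<oplus> \<sim> p)"]
      by simp
    then show ?thesis
      using c uw by (simp add: times_comm[of _ \<zero>] zero_times)
  qed
  finally have "u \<preceq> u \<ominus> w"
    using uw by (simp add: le_neg_iff[symmetric] diff_eq)
  then show ?thesis
    using uw le_antisym diff_le by (metis closed(5) u_def w_def)
qed

primrec mult :: "nat \<Rightarrow> 'a \<Rightarrow> 'a"
  where "mult 0 x = \<zero>" | "mult (Suc n) x = x \<oplus> mult n x"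

lemma mult_closed [simp, intro]: "x \<in> carrier A \<Longrightarrow> mult n x \<in> carrier A"
  by (induction n) auto

lemma mult_add: "x \<in> carrier A \<Longrightarrow> mult (m + n) x = mult m x \<oplus> mult n x"
  by (induction m) (auto simp: plus_assoc)

lemma diff_mult:
  assumes "x \<in> carrier A" "y \<in> carrier A" "x \<ominus> y = x"
  shows "x \<ominus> mult n y = x"
  using assms by (induction n) (auto simp: diff_diff[symmetric], simp add: diff_eq)

end

section \<open>Binary digits and Hoelder's theorem for MV-algebras\<close>

text \<open>After \<open>n\<close> steps the error is at most \<open>\<bar>K\<bar> / 2 ^ n\<close>.
  The index set is arbitrary because additivity is an error of pairs, while complementation and
  uniqueness concern single elements.\<close>

lemma halving_le_zero:
  fixes E :: "'s \<Rightarrow> real"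
  assumes bound: "\<And>s. s \<in> S \<Longrightarrow> E s \<le> K"
    and step: "\<And>s. s \<in> S \<Longrightarrow> E s \<le> 0 \<or> (\<exists>t\<in>S. E s \<le> E t / 2)"
    and s: "s \<in> S"
  shows "E s \<le> 0"
proof -
  have K: "E s \<le> \<bar>K\<bar> / 2 ^ n" if "s \<in> S" for n s
    using that
  proof (induction n arbitrary: s)
    case 0
    then show ?case
      using bound[of s] by simp
  next
    case (Suc n)
    consider "E s \<le> 0" | t where "t \<in> S" "E s \<le> E t / 2"
      using step Suc.prems by blast
    then show ?case
    proof cases
      case 1
      then show ?thesis
        by (meson abs_ge_zero divide_nonneg_nonneg order_trans zero_le_numeral zero_le_power)
    next
      case 2
      then show ?thesis
        using Suc.IH[of t] by simp
    qed
  qed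
  have "(\<lambda>n. \<bar>K\<bar> * (1 / 2) ^ n) \<longlonglongrightarrow> \<bar>K\<bar> * 0"
    by (intro tendsto_mult tendsto_const LIMSEQ_realpow_zero) auto
  then have "(\<lambda>n. \<bar>K\<bar> / 2 ^ n) \<longlonglongrightarrow> 0"
    by (simp add: power_one_over)
  then show ?thesis
    using K[OF s] by (intro LIMSEQ_le_const) auto
qed

text \<open>The properties of \<open>A/M\<close> from which the embedding is built. Simplicity
  appears in its archimedean form, which is what a maximal ideal provides and what injectivity of
  \<open>val\<close> consumes.\<close>

locale simple_mv_chain = mv_algebra +
  assumes total: "\<lbrakk>x \<in> carrier A; y \<in> carrier A\<rbrakk> \<Longrightarrow> x \<preceq> y \<or> y \<preceq> x"
    and simple: "\<lbrakk>x \<in> carrier A; x \<noteq> \<zero>\<rbrakk> \<Longrightarrow> \<exists>n. mult n x = \<sim> \<zero>"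
    and nontrivial: "\<sim> \<zero> \<noteq> \<zero>"
begin

definition dbl :: "'a \<Rightarrow> 'a"
  where "dbl x = (if x \<odot> x = \<zero> then x \<oplus> x else x \<odot> x)"

text \<open>Only a strict overflow counts as 1: an element equal to its own complement has the
  expansion 0.0111..., and the digits of \<open>\<sim> \<zero>\<close> are all 1.\<close>

definition digit :: "'a \<Rightarrow> real"
  where "digit x = (if x \<odot> x = \<zero> then 0 else 1)"

definition val :: "'a \<Rightarrow> real"
  where "val x = (\<Sum>n. digit ((dbl ^^ n) x) / 2 ^ Suc n)"

lemma digit_sums: "summable (\<lambda>n. digit ((dbl ^^ n) x) / 2 ^ Suc n)"
proof (rule summable_comparison_test')
  show "summable (\<lambda>n. (1 / 2) ^ Suc n :: real)"
    by (intro summable_Suc_iff[THEN iffD2] summable_geometric) auto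
  show "norm (digit ((dbl ^^ n) x) / 2 ^ Suc n) \<le> (1 / 2) ^ Suc n" for n
    by (auto simp: digit_def power_one_over)
qed

text \<open>Removing the leading digit shifts the expansion. Apart from the bounds 0 and 1, all
  facts about \<open>val\<close> come from this recursion and not from the series.\<close>

lemma val_rec: "val x = digit x / 2 + val (dbl x) / 2"
proof -
  have "val x = (\<Sum>n. digit ((dbl ^^ Suc n) x) / 2 ^ Suc (Suc n)) + digit x / 2"
    unfolding val_def using suminf_split_head[OF digit_sums[of x]] by simp
  also have "(\<Sum>n. digit ((dbl ^^ Suc n) x) / 2 ^ Suc (Suc n)) = val (dbl x) / 2"
    unfolding val_def using suminf_divide[OF digit_sums[of "dbl x"], of 2]
    by (simp add: funpow_swap1 mult.commute)
  finally show ?thesis by simp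
qed

lemma val_nonneg: "0 \<le> val x"
  unfolding val_def by (intro suminf_nonneg digit_sums) (auto simp: digit_def)

lemma val_le_one: "val x \<le> 1"
proof -
  have s: "(\<lambda>n. (1 / 2) ^ Suc n :: real) sums 1"
    by (rule power_half_series)
  have "val x \<le> (\<Sum>n. (1 / 2) ^ Suc n)"
    unfolding val_def
    by (intro suminf_le digit_sums sums_summable[OF s]) (auto simp: digit_def power_one_over)
  then show ?thesis
    using sums_unique[OF s] by simp
qed

lemma val_low: "x \<odot> x = \<zero> \<Longrightarrow> val x = val (x \<oplus> x) / 2"
  using val_rec[of x] by (simp add: digit_def dbl_def)

lemma val_high: "x \<odot> x \<noteq> \<zero> \<Longrightarrow> val x = (1 + val (x \<odot> x)) / 2"
  using val_rec[of x] by (simp add: digit_def dbl_def)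

lemma val_zero: "val \<zero> = 0"
  using val_low[of \<zero>] by (simp add: zero_times)

lemma val_one: "val (\<sim> \<zero>) = 1"
proof -
  have "\<sim> \<zero> \<odot> \<sim> \<zero> = \<sim> \<zero>"
    by (simp add: mv_times_def)
  then show ?thesis
    using val_high[of "\<sim> \<zero>"] nontrivial by simp
qed

lemma times_eq_zero_or:
  "\<lbrakk>x \<in> carrier A; y \<in> carrier A\<rbrakk> \<Longrightarrow> x \<odot> y = \<zero> \<or> x \<oplus> y = \<sim> \<zero>"
  using total[of x "\<sim> y"] by (auto simp: le_neg_iff) (simp add: le_def plus_comm)

lemma neg_times: "\<lbrakk>x \<in> carrier A; y \<in> carrier A\<rbrakk> \<Longrightarrow> \<sim> x \<odot> \<sim> y = \<sim> (x \<oplus> y)"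
  by (simp add: mv_times_def)

lemma neg_plus: "\<lbrakk>x \<in> carrier A; y \<in> carrier A\<rbrakk> \<Longrightarrow> \<sim> x \<oplus> \<sim> y = \<sim> (x \<odot> y)"
  by (simp add: mv_times_def)

lemma val_neg:
  assumes "x \<in> carrier A"
  shows "val (\<sim> x) = 1 - val x"
proof -
  have "\<bar>val (\<sim> x) - (1 - val x)\<bar> \<le> 0"
  proof (rule halving_le_zero[where S = "carrier A" and K = 1])
    fix x assume x: "x \<in> carrier A"
    show "\<bar>val (\<sim> x) - (1 - val x)\<bar> \<le> 1"
      using val_nonneg[of x] val_nonneg[of "\<sim> x"] val_le_one[of x] val_le_one[of "\<sim> x"] by linarith
    \<comment> \<open>Complementing an element exchanges its leading digits 0 and 1, except at a
      half, where both elements have leading digit 0 and double to \<open>\<sim> \<zero>\<close>;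
      that case is computed directly.\<close>
    consider (half) "x \<odot> x = \<zero>" "x \<oplus> x = \<sim> \<zero>" | (low) "x \<odot> x = \<zero>" "x \<oplus> x \<noteq> \<sim> \<zero>"
      | (high) "x \<odot> x \<noteq> \<zero>" "x \<oplus> x = \<sim> \<zero>"
      using times_eq_zero_or[OF x x] by blast
    then show "\<bar>val (\<sim> x) - (1 - val x)\<bar> \<le> 0 \<or>
        (\<exists>t\<in>carrier A. \<bar>val (\<sim> x) - (1 - val x)\<bar> \<le> \<bar>val (\<sim> t) - (1 - val t)\<bar> / 2)"
    proof cases
      case half
      then show ?thesis
        using x val_low[of x] val_low[of "\<sim> x"] by (simp add: neg_times neg_plus val_one)
    next
      case low
      then have "val (\<sim> x) = (1 + val (\<sim> (x \<oplus> x))) / 2"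
        using x val_high[of "\<sim> x"] by (simp add: neg_times neg_eq_zero)
      then show ?thesis
        using x low val_low[of x]
        by (intro disjI2 bexI[of _ "x \<oplus> x"]) (auto simp: abs_if field_simps)
    next
      case high
      then have "val (\<sim> x) = val (\<sim> (x \<odot> x)) / 2"
        using x val_low[of "\<sim> x"] by (simp add: neg_times neg_plus)
      then show ?thesis
        using x high val_high[of x]
        by (intro disjI2 bexI[of _ "x \<odot> x"]) (auto simp: abs_if field_simps)
    qed
  qed fact
  then show ?thesis by simp
qed

text \<open>If doubling the sum does not overflow, neither does any sum of two elements below
  \<open>x \<oplus> y\<close>. So there is no carry, and the doubled pair again satisfies the
  hypothesis of additivity.\<close>

lemma dbl_plus_low:
  assumes c: "x \<in> carrier A" "y \<in> carrier A"
    and z: "(x \<oplus> y) \<odot> (x \<oplus> y) = \<zero>"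
  shows "x \<odot> x = \<zero>" "y \<odot> y = \<zero>" "x \<odot> y = \<zero>" "(x \<oplus> x) \<odot> (y \<oplus> y) = \<zero>"
proof -
  have below: "a \<odot> b = \<zero>" if "a \<preceq> x \<oplus> y" "b \<preceq> x \<oplus> y" "a \<in> carrier A" "b \<in> carrier A" for a b
    using times_mono[OF that(3) _ that(4) _ that(1,2)] c z that by (simp add: le_zero_iff)
  have xy: "x \<preceq> x \<oplus> y" "y \<preceq> x \<oplus> y" "x \<oplus> y \<preceq> x \<oplus> y"
    using c le_plus[of x y] le_plus[of y x] by (simp_all add: plus_comm le_refl)
  show 1: "x \<odot> x = \<zero>" "y \<odot> y = \<zero>" "x \<odot> y = \<zero>"
    using below xy c by blast+
  have 2: "y \<odot> (x \<oplus> y) = \<zero>"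
    using below xy c by blast
  then have 3: "x \<odot> (y \<oplus> (x \<oplus> y)) = \<zero>"
    using times_plus_assoc[of x y "x \<oplus> y"] c 1 z by simp
  have "x \<odot> (y \<oplus> y) \<preceq> x \<odot> (y \<oplus> (x \<oplus> y))"
    using c xy by (intro times_mono plus_mono le_refl) auto
  then have "x \<odot> (y \<oplus> y) = \<zero>"
    using c 3 by (simp add: le_zero_iff)
  then show "(x \<oplus> x) \<odot> (y \<oplus> y) = \<zero>"
    using c 1 3 times_plus_assoc[of x x "y \<oplus> y"] by (simp add: plus_ac)
qed

text \<open>Both sides stand for the positive part of \<open>2 * x + 2 * y - 1\<close>. The mixed
  associativity laws have side conditions that depend on whether \<open>2 * x + y\<close> and
  \<open>x + 2 * y\<close> overflow, and totality decides between the cases.\<close>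

lemma dbl_plus_cross:
  assumes c: "x \<in> carrier A" "y \<in> carrier A"
    and low: "x \<odot> x = \<zero>" "y \<odot> y = \<zero>" "x \<odot> y = \<zero>"
  shows "(x \<oplus> y) \<odot> (x \<oplus> y) = (x \<oplus> x) \<odot> (y \<oplus> y)"
proof -
  have yx: "y \<odot> x = \<zero>"
    using low c times_comm by simp
  have shift: "(x \<oplus> y) \<odot> y = x \<odot> (y \<oplus> y)" "(y \<oplus> y) \<odot> x = y \<odot> (x \<oplus> y)"
    using c low yx times_plus_assoc[of x y y] times_plus_assoc[of y y x] by (simp_all add: plus_comm)
  have aux: "(a \<oplus> b) \<odot> (a \<oplus> b) = (a \<oplus> a) \<odot> (b \<oplus> b)"
    if c: "a \<in> carrier A" "b \<in> carrier A"
    and low: "a \<odot> a = \<zero>" "b \<odot> b = \<zero>" "a \<odot> b = \<zero>" and z: "b \<odot> (a \<oplus> b) = \<zero>" for a b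
  proof -
    have ba: "b \<odot> a = \<zero>"
      using low c times_comm by simp
    then have "(b \<oplus> b) \<odot> a = \<zero>"
      using c low z times_plus_assoc[of b b a] by (simp add: plus_comm)
    then have "a \<odot> (b \<oplus> b) = \<zero>"
      using c times_comm by simp
    then show ?thesis
      using c low z times_plus_assoc[of a b "a \<oplus> b"] times_plus_assoc[of a a "b \<oplus> b"]
      by (simp add: plus_ac)
  qed
  consider "y \<odot> (x \<oplus> y) = \<zero>" | "x \<odot> (y \<oplus> x) = \<zero>"
    | (large) "y \<oplus> (x \<oplus> y) = \<sim> \<zero>" "x \<oplus> (y \<oplus> x) = \<sim> \<zero>"
    using times_eq_zero_or c by (meson closed(1))
  then show ?thesis
  proof cases
    case 1
    then show ?thesis using aux[of x y] c low by blast
  next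
    case 2
    then have "(y \<oplus> x) \<odot> (y \<oplus> x) = (y \<oplus> y) \<odot> (x \<oplus> x)"
      using aux[of y x] c low yx by blast
    then show ?thesis using c by (simp add: plus_comm times_comm)
  next
    case large
    have "(x \<oplus> y) \<odot> (x \<oplus> y) = ((x \<oplus> y) \<odot> y) \<oplus> x"
      using c large yx plus_times_assoc[of "x \<oplus> y" y x] by (simp add: plus_comm)
    also have "\<dots> = ((y \<oplus> y) \<odot> x) \<oplus> x"
      using c shift by (simp add: times_comm)
    also have "\<dots> = (y \<oplus> y) \<odot> (x \<oplus> x)"
      using c large low plus_times_assoc[of "y \<oplus> y" x x] by (simp add: plus_ac)
    finally show ?thesis
      using c by (simp add: times_comm)
  qed
qed

text \<open>Here \<open>y \<preceq> \<sim> x \<preceq> x\<close>, so \<open>y\<close> has digit 0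
  and the carry comes from \<open>x\<close> alone: \<open>2 * (x + y) - 1\<close> is
  \<open>(2 * x - 1) + 2 * y\<close>.\<close>

lemma dbl_plus_high:
  assumes c: "x \<in> carrier A" "y \<in> carrier A"
    and xy: "x \<odot> y = \<zero>" and xx: "x \<odot> x \<noteq> \<zero>"
  shows "(x \<oplus> y) \<odot> (x \<oplus> y) = (x \<odot> x) \<oplus> (y \<oplus> y)" "(x \<odot> x) \<odot> (y \<oplus> y) = \<zero>" "y \<odot> y = \<zero>"
proof -
  have one: "x \<oplus> x = \<sim> \<zero>"
    using xx times_eq_zero_or c by blast
  have yx: "y \<odot> x = \<zero>"
    using xy c times_comm by simp
  have y: "y \<preceq> \<sim> x" "\<sim> x \<preceq> x"
    using c yx le_neg_iff[of y x] one by (simp_all add: le_def)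
  have "y \<odot> y \<preceq> y \<odot> x"
    using c y le_trans[of y "\<sim> x" x] by (intro times_mono le_refl) auto
  then show yy: "y \<odot> y = \<zero>"
    using c yx by (simp add: le_zero_iff)
  have "(x \<odot> x) \<oplus> y = x \<odot> (x \<oplus> y)"
    using plus_times_assoc[of x x y] c one xy by simp
  moreover have "((x \<oplus> y) \<odot> x) \<oplus> y = (x \<oplus> y) \<odot> (x \<oplus> y)"
    using plus_times_assoc[of "x \<oplus> y" x y] c one xy plus_lcomm[of x y x]
    by (simp add: plus_ac)
  ultimately show "(x \<oplus> y) \<odot> (x \<oplus> y) = (x \<odot> x) \<oplus> (y \<oplus> y)"
    using c by (simp add: times_comm plus_assoc[symmetric])
  have "(y \<oplus> y) \<odot> x = y \<odot> (y \<oplus> x)"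
    using times_plus_assoc[of y y x] c yy yx by simp
  then have "(x \<odot> x) \<odot> (y \<oplus> y) = x \<odot> (y \<odot> (y \<oplus> x))"
    using c times_comm[of "y \<oplus> y" x] by (simp add: times_assoc)
  also have "\<dots> = (x \<odot> y) \<odot> (y \<oplus> x)"
    using c by (simp add: times_assoc)
  finally show "(x \<odot> x) \<odot> (y \<oplus> y) = \<zero>"
    using c xy by (simp add: zero_times)
qed

text \<open>The leading digits of \<open>x\<close>, \<open>y\<close> and \<open>x \<oplus> y\<close> are consistent with addition and carry, so the
  defect of additivity at \<open>(x, y)\<close> is half its value at another pair.\<close>

lemma val_plus:
  assumes "x \<in> carrier A" "y \<in> carrier A" "x \<odot> y = \<zero>"
  shows "val (x \<oplus> y) = val x + val y"
proof -
  define S where "S = {(x, y). x \<in> carrier A \<and> y \<in> carrier A \<and> x \<odot> y = \<zero>}"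
  define E where "E = (\<lambda>(x, y). \<bar>val (x \<oplus> y) - (val x + val y)\<bar>)"
  have half: "E (x, y) \<le> E (x', y') / 2 \<and> (x', y') \<in> S"
    if "x' \<in> carrier A" "y' \<in> carrier A" "x' \<odot> y' = \<zero>"
      "val (x \<oplus> y) - (val x + val y) = (val (x' \<oplus> y') - (val x' + val y')) / 2 \<or>
       val (x \<oplus> y) - (val x + val y) = - (val (x' \<oplus> y') - (val x' + val y')) / 2"
    for x y x' y'
    using that by (auto simp: E_def S_def abs_if split: if_splits)
  have high: "\<exists>t\<in>S. E (x, y) \<le> E t / 2"
    if c: "x \<in> carrier A" "y \<in> carrier A" and xy: "x \<odot> y = \<zero>" and xx: "x \<odot> x \<noteq> \<zero>" for x y
  proof -
    have "x \<odot> x \<preceq> (x \<oplus> y) \<odot> (x \<oplus> y)"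
      using c by (intro times_mono le_plus) auto
    then have z: "(x \<oplus> y) \<odot> (x \<oplus> y) \<noteq> \<zero>"
      using c xx by (auto simp: le_zero_iff)
    have "val (x \<oplus> y) - (val x + val y)
        = (val ((x \<odot> x) \<oplus> (y \<oplus> y)) - (val (x \<odot> x) + val (y \<oplus> y))) / 2"
      using val_high[OF xx] val_high[OF z] val_low[of y] dbl_plus_high[OF c xy xx]
      by (simp add: field_simps)
    then show ?thesis
      using half[of "x \<odot> x" "y \<oplus> y"] c dbl_plus_high[OF c xy xx] by blast
  qed
  have comm: "E (x, y) = E (y, x)" if "x \<in> carrier A" "y \<in> carrier A" for x y
    using that by (simp add: E_def plus_comm add.commute)
  have "E (x, y) \<le> 0"
  proof (rule halving_le_zero[where S = S and K = 2])
    fix s assume "s \<in> S"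
    then obtain x y where s: "s = (x, y)" and c: "x \<in> carrier A" "y \<in> carrier A"
      and xy: "x \<odot> y = \<zero>"
      by (auto simp: S_def)
    show "E s \<le> 2"
      using val_nonneg[of x] val_nonneg[of y] val_nonneg[of "x \<oplus> y"]
        val_le_one[of x] val_le_one[of y] val_le_one[of "x \<oplus> y"]
      by (simp add: E_def s)
    have "\<exists>t\<in>S. E (x, y) \<le> E t / 2"
    proof (cases "x \<odot> x = \<zero> \<and> y \<odot> y = \<zero>")
      case False
      then show ?thesis
        using high[of x y] high[of y x] comm[of x y] c xy times_comm[of x y] by auto
    next
      case low: True
      show ?thesis
      proof (cases "(x \<oplus> y) \<odot> (x \<oplus> y) = \<zero>")
        case True
        have "(x \<oplus> y) \<oplus> (x \<oplus> y) = (x \<oplus> x) \<oplus> (y \<oplus> y)"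
          using c by (simp add: plus_ac)
        then have "val (x \<oplus> y) - (val x + val y)
            = (val ((x \<oplus> x) \<oplus> (y \<oplus> y)) - (val (x \<oplus> x) + val (y \<oplus> y))) / 2"
          using val_low[OF True] low val_low[of x] val_low[of y] by (simp add: field_simps)
        then show ?thesis
          using half[of "x \<oplus> x" "y \<oplus> y"] c dbl_plus_low[OF c True] by blast
      next
        case False
        have one: "(x \<oplus> x) \<oplus> (y \<oplus> y) = \<sim> \<zero>"
          using times_eq_zero_or[of "x \<oplus> y" "x \<oplus> y"] False c by (simp add: plus_ac)
        \<comment> \<open>Both leading digits are 0 but the sum has digit 1. The doubled pair may
          now overflow, so the step passes to its complements. This reverses the sign of the defect,
          hence the absolute value in \<open>E\<close> and the need for \<open>val_neg\<close>
          beforehand.\<close>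
        let ?x = "\<sim> (x \<oplus> x)" and ?y = "\<sim> (y \<oplus> y)"
        have "?x \<odot> ?y = \<zero>"
          using c one by (simp add: neg_times)
        moreover have "?x \<oplus> ?y = \<sim> ((x \<oplus> y) \<odot> (x \<oplus> y))"
          using c low xy by (simp add: neg_plus dbl_plus_cross)
        then have "val (x \<oplus> y) - (val x + val y) = - (val (?x \<oplus> ?y) - (val ?x + val ?y)) / 2"
          using val_high[OF False] low val_low[of x] val_low[of y] c
          by (simp add: val_neg field_simps)
        ultimately show ?thesis
          using half[of ?x ?y x y] c by blast
      qed
    qed
    then show "E s \<le> 0 \<or> (\<exists>t\<in>S. E s \<le> E t / 2)"
      by (simp add: s)
  qed (use assms in \<open>simp add: S_def\<close>)
  then show ?thesis
    by (simp add: E_def)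
qed

text \<open>An element of value zero has only digits 0, so it can be doubled forever without
  overflow and keeps value zero. Some multiple of a nonzero element is
  \<open>\<sim> \<zero>\<close>, and so is the larger multiple \<open>2 ^ n\<close>, which has value
  1.\<close>

lemma val_eq_zero:
  assumes x: "x \<in> carrier A" and "val x = 0"
  shows "x = \<zero>"
proof (rule ccontr)
  have dyadic: "val (mult (2 ^ n) x) = 0" for n
  proof (induction n)
    case 0
    then show ?case using assms by simp
  next
    case (Suc n)
    let ?y = "mult (2 ^ n) x"
    have "?y \<odot> ?y = \<zero>"
      using val_high[of ?y] Suc val_nonneg[of "?y \<odot> ?y"] by fastforce
    then have "val (?y \<oplus> ?y) = 0"
      using val_low[of ?y] Suc by simp
    then show ?case
      using x mult_add[of x "2 ^ n" "2 ^ n"] by (simp add: mult_2)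
  qed
  assume "x \<noteq> \<zero>"
  then obtain n where n: "mult n x = \<sim> \<zero>"
    using simple x by blast
  have "mult (2 ^ n) x = \<sim> \<zero>"
    using mult_add[of x n "2 ^ n - n"] n x by (simp add: less_imp_le)
  then show False
    using dyadic[of n] val_one by simp
qed

text \<open>Where \<open>x \<oplus> y\<close> overflows, the complements do not, and additivity for
  them shows that \<open>val x + val y\<close> is at least 1. Injectivity reduces by totality to
  comparable elements, whose difference has value zero.\<close>

theorem hoelder: "restrict val (carrier A) \<in> mv_hom A unit_mv"
  "inj_on (restrict val (carrier A)) (carrier A)"
proof -
  have plus: "val (x \<oplus> y) = min 1 (val x + val y)" if c: "x \<in> carrier A" "y \<in> carrier A" for x y
    using times_eq_zero_or[OF c]
  proof
    assume "x \<odot> y = \<zero>"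
    then show ?thesis
      using val_plus c val_le_one[of "x \<oplus> y"] by simp
  next
    assume one: "x \<oplus> y = \<sim> \<zero>"
    then have "val (\<sim> x \<oplus> \<sim> y) = val (\<sim> x) + val (\<sim> y)"
      using c by (intro val_plus) (auto simp: neg_times)
    then show ?thesis
      using one val_one val_le_one[of "\<sim> x \<oplus> \<sim> y"] c by (simp add: val_neg)
  qed
  show "restrict val (carrier A) \<in> mv_hom A unit_mv"
    by (auto simp: mv_hom_def unit_mv_def val_nonneg val_le_one val_zero val_neg plus)
  have eq: "x = y" if c: "x \<in> carrier A" "y \<in> carrier A" and "val x = val y" "x \<preceq> y" for x y
  proof -
    have "x \<odot> (y \<ominus> x) = \<zero>"
      using c diff_le[of "\<sim> x" "\<sim> y"]
      by (simp add: le_neg_iff[symmetric] times_comm[of x] times_comm[of y] diff_def)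
    then have "val (x \<oplus> (y \<ominus> x)) = val x + val (y \<ominus> x)"
      using c by (intro val_plus) auto
    then have "y \<ominus> x = \<zero>"
      using that plus_diff[of x y] by (intro val_eq_zero) auto
    then show ?thesis
      using that plus_diff[of x y] by simp
  qed
  then show "inj_on (restrict val (carrier A)) (carrier A)"
    using total by (intro inj_onI) (metis restrict_apply')
qed

end

section \<open>Maximal ideals and homomorphisms into the unit interval\<close>

lemma mv_ideal_maximal: "M \<in> MaxI A \<Longrightarrow> mv_ideal M A"
  by (simp add: MaxI_def)

locale mv_maximal = mv_algebra +
  fixes M
  assumes maximal: "M \<in> MaxI A"
begin

lemma ideal_carrier: "x \<in> M \<Longrightarrow> x \<in> carrier A"
  and ideal_zero [simp]: "\<zero> \<in> M"
  and ideal_plus: "\<lbrakk>x \<in> M; y \<in> M\<rbrakk> \<Longrightarrow> x \<oplus> y \<in> M"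
  and ideal_down: "\<lbrakk>x \<in> M; y \<in> carrier A; y \<preceq> x\<rbrakk> \<Longrightarrow> y \<in> M"
  using mv_ideal_maximal[OF maximal] by (auto simp: mv_ideal_def le_iff)

lemma one_notin_ideal: "\<sim> \<zero> \<notin> M"
proof
  assume "\<sim> \<zero> \<in> M"
  then have "carrier A \<subseteq> M"
    using ideal_down le_one by blast
  then show False
    using maximal ideal_carrier by (auto simp: MaxI_def)
qed

text \<open>The set \<open>I\<close> is the ideal generated by \<open>M\<close> and
  \<open>x\<close>, so maximality makes it contain \<open>\<sim> \<zero>\<close>.\<close>

lemma maximal_mult:
  assumes x: "x \<in> carrier A" "x \<notin> M"
  obtains n m where "m \<in> M" "mult n x \<oplus> m = \<sim> \<zero>"
proof -
  define I where "I = {y \<in> carrier A. \<exists>n. \<exists>m\<in>M. y \<preceq> mult n x \<oplus> m}"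
  have "mv_ideal I A"
    unfolding mv_ideal_def
  proof (intro conjI ballI impI)
    show "I \<subseteq> carrier A"
      by (auto simp: I_def)
    show "\<zero> \<in> I"
      using zero_le by (auto simp: I_def intro!: exI[of _ 0] bexI[of _ \<zero>])
    fix y assume y: "y \<in> I"
    then obtain n m where ym: "y \<in> carrier A" "m \<in> M" "y \<preceq> mult n x \<oplus> m"
      by (auto simp: I_def)
    have m: "m \<in> carrier A"
      using ym ideal_carrier by blast
    {
      fix z assume "z \<in> I"
      then obtain k m' where z: "z \<in> carrier A" "m' \<in> M" "z \<preceq> mult k x \<oplus> m'"
        by (auto simp: I_def)
      then have m': "m' \<in> carrier A"
        using ideal_carrier by blast
      have "y \<oplus> z \<preceq> (mult n x \<oplus> m) \<oplus> (mult k x \<oplus> m')"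
        using x ym z m m' by (intro plus_mono) auto
      also have "(mult n x \<oplus> m) \<oplus> (mult k x \<oplus> m') = mult (n + k) x \<oplus> (m \<oplus> m')"
        using x m m' by (simp add: mult_add plus_ac)
      finally show "y \<oplus> z \<in> I"
        using ym z ideal_plus by (auto simp: I_def)
    }
    fix z assume z: "z \<in> carrier A" "z \<sqsubseteq>\<^bsub>mv_order A\<^esub> y"
    then have "z \<preceq> mult n x \<oplus> m"
      using le_trans[of z y "mult n x \<oplus> m"] ym m x by (simp add: le_iff)
    then show "z \<in> I"
      using z ym by (auto simp: I_def)
  qed
  moreover have "M \<subseteq> I"
  proof
    fix m assume "m \<in> M"
    then show "m \<in> I"
      using ideal_carrier le_refl by (auto simp: I_def intro!: exI[of _ 0] bexI[of _ m])
  qed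
  moreover have "x \<in> I"
    using x le_refl by (auto simp: I_def intro!: exI[of _ 1] bexI[of _ \<zero>])
  ultimately have "I = carrier A"
    using maximal x by (auto simp: MaxI_def)
  then have "\<sim> \<zero> \<in> I"
    by simp
  then obtain n m where "m \<in> M" "\<sim> \<zero> \<preceq> mult n x \<oplus> m"
    by (auto simp: I_def)
  then show thesis
    using that x ideal_carrier le_antisym[OF _ _ le_one, of "mult n x \<oplus> m"] by auto
qed

text \<open>If \<open>y \<ominus> x\<close> lies outside \<open>M\<close>, some multiple of it
  together with an element \<open>m\<close> of \<open>M\<close> reaches one. Subtracting that
  multiple leaves \<open>x \<ominus> y\<close> unchanged by prelinearity, yet the result is below
  \<open>m\<close>.\<close>

lemma maximal_prime:
  assumes c: "x \<in> carrier A" "y \<in> carrier A"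
  shows "x \<ominus> y \<in> M \<or> y \<ominus> x \<in> M"
proof (rule disjCI)
  let ?w = "x \<ominus> y" and ?u = "y \<ominus> x"
  assume "?u \<notin> M"
  then obtain n m where m: "m \<in> M" "mult n ?u \<oplus> m = \<sim> \<zero>"
    using c maximal_mult[of ?u] closed(5) by metis
  have "?w \<ominus> mult n ?u = ?w"
    using c by (intro diff_mult diff_diff_swap_eq) auto
  moreover have "?w \<ominus> mult n ?u \<preceq> m"
    using c m ideal_carrier le_one by (simp add: diff_le_iff)
  ultimately show "?w \<in> M"
    using c m ideal_down by (metis closed(5))
qed

section \<open>The quotient by a maximal ideal\<close>

abbreviation Q :: "'a set mv"
  where "Q \<equiv> mv_quot A M"

definition cls :: "'a \<Rightarrow> 'a set"
  where "cls x = mv_cong A M `` {x}"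

lemma cong_iff:
  "(x, y) \<in> mv_cong A M \<longleftrightarrow> x \<in> carrier A \<and> y \<in> carrier A \<and> x \<ominus> y \<in> M \<and> y \<ominus> x \<in> M"
proof -
  have "x \<ominus> y \<in> M \<and> y \<ominus> x \<in> M"
    if c: "x \<in> carrier A" "y \<in> carrier A" and s: "(x \<ominus> y) \<oplus> (y \<ominus> x) \<in> M"
    using ideal_down[OF s] le_plus[of "x \<ominus> y" "y \<ominus> x"] le_plus[of "y \<ominus> x" "x \<ominus> y"] c
      plus_comm[of "x \<ominus> y" "y \<ominus> x"]
    by auto
  then show ?thesis
    using ideal_plus by (auto simp: mv_cong_def diff_def)
qed

lemma diff_trans:
  assumes c: "x \<in> carrier A" "y \<in> carrier A" "z \<in> carrier A" and "x \<ominus> y \<in> M" "y \<ominus> z \<in> M"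
  shows "x \<ominus> z \<in> M"
proof -
  have "y \<oplus> (x \<ominus> y) \<preceq> (z \<oplus> (y \<ominus> z)) \<oplus> (x \<ominus> y)"
    using c le_plus_diff[of y z] by (intro plus_mono le_refl) auto
  then have "x \<preceq> (z \<oplus> (y \<ominus> z)) \<oplus> (x \<ominus> y)"
    using c le_trans[of x "y \<oplus> (x \<ominus> y)"] le_plus_diff[of x y] by simp
  then have "x \<ominus> z \<preceq> (y \<ominus> z) \<oplus> (x \<ominus> y)"
    using c by (simp add: diff_le_iff plus_assoc)
  then show ?thesis
    using assms ideal_down ideal_plus by (metis closed(5))
qed

lemma diff_plus_plus:
  assumes c: "x \<in> carrier A" "y \<in> carrier A" "x' \<in> carrier A" "y' \<in> carrier A"
    and "x \<ominus> x' \<in> M" "y \<ominus> y' \<in> M"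
  shows "(x \<oplus> y) \<ominus> (x' \<oplus> y') \<in> M"
proof -
  have "x \<oplus> y \<preceq> (x' \<oplus> (x \<ominus> x')) \<oplus> (y' \<oplus> (y \<ominus> y'))"
    using c by (intro plus_mono le_plus_diff) auto
  also have "\<dots> = (x' \<oplus> y') \<oplus> ((x \<ominus> x') \<oplus> (y \<ominus> y'))"
    using c by (simp add: plus_ac)
  finally have "(x \<oplus> y) \<ominus> (x' \<oplus> y') \<preceq> (x \<ominus> x') \<oplus> (y \<ominus> y')"
    using c by (simp add: diff_le_iff)
  then show ?thesis
    using assms ideal_down ideal_plus by (metis closed(1,5))
qed

lemma diff_neg_neg: "\<lbrakk>x \<in> carrier A; y \<in> carrier A\<rbrakk> \<Longrightarrow> \<sim> x \<ominus> \<sim> y = y \<ominus> x"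
  by (simp add: diff_eq plus_comm)

lemma equiv_cong: "equiv (carrier A) (mv_cong A M)"
proof (rule equivI)
  show "mv_cong A M \<subseteq> carrier A \<times> carrier A"
    by (auto simp: cong_iff)
  show "refl_on (carrier A) (mv_cong A M)"
    by (auto simp: refl_on_def cong_iff diff_eq)
  show "sym (mv_cong A M)"
    by (auto simp: sym_def cong_iff)
  show "trans (mv_cong A M)"
    by (rule transI) (use diff_trans in \<open>auto simp: cong_iff\<close>)
qed

lemma cls_eq_iff:
  "\<lbrakk>x \<in> carrier A; y \<in> carrier A\<rbrakk> \<Longrightarrow> cls x = cls y \<longleftrightarrow> x \<ominus> y \<in> M \<and> y \<ominus> x \<in> M"
  unfolding cls_def by (subst eq_equiv_class_iff[OF equiv_cong]) (auto simp: cong_iff)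

lemma carrier_quot: "carrier Q = cls ` carrier A"
  by (auto simp: mv_quot_def quotient_def cls_def)

lemma in_cls: "x \<in> carrier A \<Longrightarrow> y \<in> cls x \<longleftrightarrow> y \<in> carrier A \<and> cls y = cls x"
  using cls_eq_iff by (auto simp: cls_def cong_iff)

lemma quot_zero: "\<zero>\<^bsub>Q\<^esub> = cls \<zero>"
  by (simp add: mv_quot_def cls_def)

text \<open>\<open>mv_quot\<close> takes the union over all representatives; compatibility with the
  congruence makes that family constant, and the class is nonempty.\<close>

lemma quot_neg:
  assumes x: "x \<in> carrier A"
  shows "\<sim>\<^bsub>Q\<^esub> (cls x) = cls (\<sim> x)"
proof -
  have "cls (\<sim> y) = cls (\<sim> x)" if "y \<in> cls x" for y
    using that x cls_eq_iff[of y x] by (auto simp: in_cls cls_eq_iff diff_neg_neg)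
  then have "(\<Union>y\<in>cls x. cls (\<sim> y)) = cls (\<sim> x)"
    using x in_cls by (intro UN_constant_eq) blast+
  then show ?thesis
    by (simp add: mv_quot_def cls_def)
qed

lemma quot_plus:
  assumes x: "x \<in> carrier A" and y: "y \<in> carrier A"
  shows "cls x \<oplus>\<^bsub>Q\<^esub> cls y = cls (x \<oplus> y)"
proof -
  have "cls (x' \<oplus> y') = cls (x \<oplus> y)" if "x' \<in> cls x" "y' \<in> cls y" for x' y'
    using that x y cls_eq_iff[of x' x] cls_eq_iff[of y' y]
    by (auto simp: in_cls cls_eq_iff intro!: diff_plus_plus)
  then have "(\<Union>x'\<in>cls x. \<Union>y'\<in>cls y. cls (x' \<oplus> y')) = cls (x \<oplus> y)"
    using x y in_cls by (intro UN_constant_eq) blast+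
  then show ?thesis
    by (simp add: mv_quot_def cls_def)
qed

lemmas quot_ops = quot_zero quot_neg quot_plus

lemma cls_eq_zero: "x \<in> carrier A \<Longrightarrow> cls x = cls \<zero> \<longleftrightarrow> x \<in> M"
proof -
  assume x: "x \<in> carrier A"
  have "x \<ominus> \<zero> = x" "\<zero> \<ominus> x = \<zero>"
    using x by (simp_all add: diff_eq)
  then show ?thesis
    using x by (simp add: cls_eq_iff)
qed

lemma cls_eq_one: "x \<in> carrier A \<Longrightarrow> cls x = cls (\<sim> \<zero>) \<longleftrightarrow> \<sim> x \<in> M"
proof -
  assume x: "x \<in> carrier A"
  have "\<sim> \<zero> \<ominus> x = \<sim> x" "x \<ominus> \<sim> \<zero> = \<zero>"
    using x by (simp_all add: diff_eq)
  then show ?thesis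
    using x by (simp add: cls_eq_iff)
qed

lemma quot_mv_algebra: "mv_algebra Q"
proof
  fix X Y assume "X \<in> carrier Q" "Y \<in> carrier Q"
  then obtain x y where c: "x \<in> carrier A" "y \<in> carrier A" and XY: "X = cls x" "Y = cls y"
    by (auto simp: carrier_quot)
  show "X \<oplus>\<^bsub>Q\<^esub> Y = Y \<oplus>\<^bsub>Q\<^esub> X"
    using plus_comm[OF c] c by (simp add: XY quot_ops)
  show "\<sim>\<^bsub>Q\<^esub> (\<sim>\<^bsub>Q\<^esub> X \<oplus>\<^bsub>Q\<^esub> Y) \<oplus>\<^bsub>Q\<^esub> Y = \<sim>\<^bsub>Q\<^esub> (\<sim>\<^bsub>Q\<^esub> Y \<oplus>\<^bsub>Q\<^esub> X) \<oplus>\<^bsub>Q\<^esub> X"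
    using lukasiewicz[OF c] c by (simp add: XY quot_ops)
qed (auto simp: carrier_quot quot_ops plus_assoc)

text \<open>Totality is primeness of \<open>M\<close> read modulo \<open>M\<close>. A class outside
  zero has a multiple whose complement lies below an element of \<open>M\<close>, so this multiple
  is one in the quotient.\<close>

lemma quot_simple_mv_chain: "simple_mv_chain Q"
proof -
  interpret Q: mv_algebra Q
    by (rule quot_mv_algebra)
  have mult: "Q.mult n (cls x) = cls (mult n x)" if "x \<in> carrier A" for n x
    using that by (induction n) (auto simp: quot_ops)
  show ?thesis
  proof
    fix X Y assume "X \<in> carrier Q" "Y \<in> carrier Q"
    then obtain x y where c: "x \<in> carrier A" "y \<in> carrier A" and "X = cls x" "Y = cls y"
      by (auto simp: carrier_quot)
    then show "Q.le X Y \<or> Q.le Y X"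
      using maximal_prime[OF c] by (simp add: Q.le_def quot_ops cls_eq_one diff_eq)
  next
    fix X assume "X \<in> carrier Q" "X \<noteq> \<zero>\<^bsub>Q\<^esub>"
    then obtain x where x: "x \<in> carrier A" "X = cls x" and "cls x \<noteq> cls \<zero>"
      by (auto simp: carrier_quot quot_zero)
    then have "x \<notin> M"
      by (simp add: cls_eq_zero)
    with x(1) obtain n m where m: "m \<in> M" "mult n x \<oplus> m = \<sim> \<zero>"
      using maximal_mult by blast
    then have "\<sim> (mult n x) \<preceq> m"
      using x ideal_carrier by (simp add: plus_eq_one_iff)
    then have "\<sim> (mult n x) \<in> M"
      using m x ideal_down by blast
    then show "\<exists>n. Q.mult n X = \<sim>\<^bsub>Q\<^esub> \<zero>\<^bsub>Q\<^esub>"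
      using x by (auto simp: mult quot_ops cls_eq_one)
  next
    show "\<sim>\<^bsub>Q\<^esub> \<zero>\<^bsub>Q\<^esub> \<noteq> \<zero>\<^bsub>Q\<^esub>"
      using one_notin_ideal by (simp add: quot_ops cls_eq_zero)
  qed
qed

end

text \<open>Homomorphisms into \<open>unit_mv\<close> without the extensionality requirement, so
  that evaluations and composites written as lambda terms qualify without restriction to a
  carrier.\<close>

definition unit_valuation :: "'a mv \<Rightarrow> ('a \<Rightarrow> real) \<Rightarrow> bool"
  where "unit_valuation A h \<longleftrightarrow> (\<forall>x\<in>carrier A. 0 \<le> h x \<and> h x \<le> 1) \<and> h \<zero>\<^bsub>A\<^esub> = 0 \<and>
    (\<forall>x\<in>carrier A. h (\<sim>\<^bsub>A\<^esub> x) = 1 - h x) \<and>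
    (\<forall>x\<in>carrier A. \<forall>y\<in>carrier A. h (x \<oplus>\<^bsub>A\<^esub> y) = min 1 (h x + h y))"

lemma unit_valuation_hom: "h \<in> mv_hom A unit_mv \<Longrightarrow> unit_valuation A h"
  by (auto simp: mv_hom_def unit_mv_def unit_valuation_def)

lemma unit_valuation_compose:
  assumes "unit_valuation B h" "f \<in> mv_hom A B"
  shows "unit_valuation A (\<lambda>x. h (f x))"
  using assms by (auto simp: mv_hom_def unit_valuation_def PiE_iff)

context mv_algebra
begin

lemma unit_valuation_times:
  "\<lbrakk>unit_valuation A h; x \<in> carrier A; y \<in> carrier A\<rbrakk> \<Longrightarrow> h (x \<odot> y) = max 0 (h x + h y - 1)"
  by (auto simp: unit_valuation_def mv_times_def)

lemma unit_valuation_diff: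
  "\<lbrakk>unit_valuation A h; x \<in> carrier A; y \<in> carrier A\<rbrakk> \<Longrightarrow> h (x \<ominus> y) = max 0 (h x - h y)"
  by (auto simp: diff_def unit_valuation_times) (auto simp: unit_valuation_def)

lemma unit_valuation_mono:
  assumes "unit_valuation A h" "x \<in> carrier A" "y \<in> carrier A" "x \<preceq> y"
  shows "h x \<le> h y"
proof -
  have "h (x \<ominus> y) = 0"
    using assms diff_eq_zero[of x y] by (simp add: unit_valuation_def)
  then show ?thesis
    using assms unit_valuation_diff[of h x y] by simp
qed

lemma unit_valuation_eqI:
  assumes g: "unit_valuation A g" and h: "unit_valuation A h"
    and ker: "\<And>x. x \<in> carrier A \<Longrightarrow> g x = 0 \<longleftrightarrow> h x = 0" and x: "x \<in> carrier A"
  shows "g x = h x"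
proof -
  have "\<bar>g x - h x\<bar> \<le> 0"
  proof (rule halving_le_zero[where S = "carrier A" and K = 1, OF _ _ x])
    fix x assume x: "x \<in> carrier A"
    show "\<bar>g x - h x\<bar> \<le> 1"
      using g h x unfolding unit_valuation_def by (smt (verit))
    have sq: "k (x \<odot> x) = max 0 (2 * k x - 1)" "k (x \<oplus> x) = min 1 (2 * k x)"
      if "unit_valuation A k" for k
      using x that by (simp_all add: unit_valuation_times) (simp add: unit_valuation_def)
    \<comment> \<open>\<open>g (x \<odot> x) = 0\<close> says that \<open>g x\<close> is at most a
      half. As the kernels agree, \<open>g x\<close> and \<open>h x\<close> lie on the same side,
      and doubling on that side doubles their difference without truncation.\<close>
    have "\<exists>t\<in>carrier A. \<bar>g x - h x\<bar> \<le> \<bar>g t - h t\<bar> / 2"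
    proof (cases "g (x \<odot> x) = 0")
      case True
      then have "h (x \<odot> x) = 0"
        using ker x by blast
      then have "g (x \<oplus> x) = 2 * g x" "h (x \<oplus> x) = 2 * h x"
        using True sq[OF g] sq[OF h] by simp_all
      then show ?thesis
        using x by (intro bexI[of _ "x \<oplus> x"]) (auto simp: abs_if)
    next
      case False
      then have "h (x \<odot> x) \<noteq> 0"
        using ker x by blast
      then have "g (x \<odot> x) = 2 * g x - 1" "h (x \<odot> x) = 2 * h x - 1"
        using False sq[OF g] sq[OF h] by (simp_all add: max_def split: if_splits)
      then show ?thesis
        using x by (intro bexI[of _ "x \<odot> x"]) (auto simp: abs_if)
    qed
    then show "\<bar>g x - h x\<bar> \<le> 0 \<or> (\<exists>t\<in>carrier A. \<bar>g x - h x\<bar> \<le> \<bar>g t - h t\<bar> / 2)"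
      by blast
  qed
  then show ?thesis by simp
qed

lemma unit_valuation_mult:
  assumes h: "unit_valuation A h" and x: "x \<in> carrier A"
  shows "h (mult n x) = min 1 (n * h x)"
proof (induction n)
  case 0
  then show ?case using h by (simp add: unit_valuation_def)
next
  case (Suc n)
  have "h (x \<oplus> mult n x) = min 1 (h x + h (mult n x))"
    using h x by (simp add: unit_valuation_def)
  then show ?case
    using Suc h x by (auto simp: unit_valuation_def algebra_simps min_def)
qed

text \<open>A larger ideal contains some \<open>c\<close> with \<open>h c > 0\<close>. By the
  archimedean property a multiple of \<open>c\<close> has value 1, its complement lies in the
  kernel, and the two add up to \<open>\<sim> \<zero>\<close>.\<close>

lemma kernel_maximal:
  assumes h: "unit_valuation A h"
  shows "{x \<in> carrier A. h x = 0} \<in> MaxI A" (is "?K \<in> _")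
proof -
  have one: "h (\<sim> \<zero>) = 1"
    using h by (simp add: unit_valuation_def)
  have down: "h y = 0" if "x \<in> carrier A" "h x = 0" "y \<in> carrier A" "y \<preceq> x" for x y
    using unit_valuation_mono[OF h that(3,1,4)] that h by (simp add: unit_valuation_def order_antisym)
  have "mv_ideal ?K A"
    using h by (auto simp: mv_ideal_def le_iff unit_valuation_def) (rule down)
  moreover have "?K \<noteq> carrier A"
    using one closed(2,3) by force
  moreover have "I = carrier A" if I: "mv_ideal I A" "?K \<subseteq> I" "I \<noteq> ?K" for I
  proof -
    obtain c where c: "c \<in> I" "c \<in> carrier A" "h c \<noteq> 0"
      using I unfolding mv_ideal_def by blast
    then have "h c > 0"
      using h by (auto simp: unit_valuation_def less_le)
    then obtain n where n: "1 < real n * h c"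
      using reals_Archimedean3 by blast
    have "mult n c \<in> I"
      using I c by (induction n) (auto simp: mv_ideal_def)
    moreover have "h (\<sim> (mult n c)) = 0"
      using unit_valuation_mult[OF h c(2), of n] n h c by (simp add: unit_valuation_def)
    then have "\<sim> (mult n c) \<in> I"
      using I(2) c by blast
    ultimately have "\<sim> (mult n c) \<oplus> mult n c \<in> I"
      using I(1) by (simp add: mv_ideal_def)
    then have "\<sim> \<zero> \<in> I"
      using c by simp
    then show ?thesis
      using I(1) le_one unfolding mv_ideal_def le_iff by blast
  qed
  ultimately show ?thesis
    by (auto simp: MaxI_def)
qed

end

context mv_maximal
begin

text \<open>Injectivity means that the kernel is zero, so any two embeddings have the same kernel
  and coincide. Existence is Hoelder's theorem for the quotient.\<close>

lemma mv_iota: "mv_iota A M \<in> mv_hom Q unit_mv \<and> inj_on (mv_iota A M) (carrier Q)"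
proof -
  interpret Q: simple_mv_chain Q
    by (rule quot_simple_mv_chain)
  have cls_hom: "restrict cls (carrier A) \<in> mv_hom A Q"
    by (auto simp: mv_hom_def carrier_quot quot_ops)
  have uni: "g = h"
    if g: "g \<in> mv_hom Q unit_mv" "inj_on g (carrier Q)"
      and h: "h \<in> mv_hom Q unit_mv" "inj_on h (carrier Q)" for g h
  proof (rule extensionalityI[of _ "carrier Q"])
    show "g \<in> extensional (carrier Q)" "h \<in> extensional (carrier Q)"
      using g h by (auto simp: mv_hom_def PiE_iff)
    fix X assume X: "X \<in> carrier Q"
    have ker: "k X = 0 \<longleftrightarrow> X = \<zero>\<^bsub>Q\<^esub>"
      if "k \<in> mv_hom Q unit_mv" "inj_on k (carrier Q)" "X \<in> carrier Q" for k X
    proof -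
      have "k \<zero>\<^bsub>Q\<^esub> = 0"
        using that by (simp add: mv_hom_def unit_mv_def)
      then show ?thesis
        using that inj_onD[OF that(2), of X "\<zero>\<^bsub>Q\<^esub>"] by auto
    qed
    show "g X = h X"
      using g h ker X by (intro Q.unit_valuation_eqI unit_valuation_hom) auto
  qed
  have "\<exists>!h. h \<in> mv_hom Q unit_mv \<and> inj_on h (carrier Q)"
    using Q.hoelder uni by blast
  then show ?thesis
    unfolding mv_iota_def by (rule theI')
qed

lemma unit_valuation_hat: "unit_valuation A (\<lambda>a. mv_hat A a M)"
  and hat_eq_zero: "a \<in> carrier A \<Longrightarrow> mv_hat A a M = 0 \<longleftrightarrow> a \<in> M"
proof -
  have hat: "mv_hat A a M = mv_iota A M (cls a)" if "a \<in> carrier A" for a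
    using that maximal by (simp add: mv_hat_def cls_def)
  have iota: "unit_valuation Q (mv_iota A M)" "inj_on (mv_iota A M) (carrier Q)"
    using mv_iota unit_valuation_hom by auto
  have c: "cls a \<in> carrier Q" if "a \<in> carrier A" for a
    using that by (simp add: carrier_quot)
  show "unit_valuation A (\<lambda>a. mv_hat A a M)"
    using iota(1) c by (auto simp: unit_valuation_def hat quot_ops[symmetric])
  assume a: "a \<in> carrier A"
  have "mv_iota A M (cls \<zero>) = 0"
    using iota(1) by (simp add: unit_valuation_def quot_zero)
  then show "mv_hat A a M = 0 \<longleftrightarrow> a \<in> M"
    using a c inj_onD[OF iota(2), of "cls a" "cls \<zero>"] hat[OF a] cls_eq_zero[OF a] c[of \<zero>] by auto
qed

end

context mv_algebra
begin

lemma hat_valuation: "M \<in> MaxI A \<Longrightarrow> unit_valuation A (\<lambda>a. mv_hat A a M)"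
  using mv_maximal.unit_valuation_hat[of A M] mv_algebra_axioms
  by (simp add: mv_maximal_def mv_maximal_axioms_def)

lemma hat_zero_iff: "\<lbrakk>M \<in> MaxI A; a \<in> carrier A\<rbrakk> \<Longrightarrow> mv_hat A a M = 0 \<longleftrightarrow> a \<in> M"
  using mv_maximal.hat_eq_zero[of A M a] mv_algebra_axioms
  by (simp add: mv_maximal_def mv_maximal_axioms_def)

text \<open>A valuation and evaluation of \<open>mv_hat A\<close> at its kernel have the same zeros.
  In this form every valuation of \<open>A\<close> becomes a point of \<open>MaxI A\<close>.\<close>

lemma hat_kernel:
  assumes "unit_valuation A h" "a \<in> carrier A"
  shows "mv_hat A a {x \<in> carrier A. h x = 0} = h a"
  using assms kernel_maximal[OF assms(1)]
  by (intro unit_valuation_eqI[of _ h]) (auto simp: hat_valuation hat_zero_iff)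

lemma hat_hom: "mv_hat A \<in> mv_hom A (fuzzy (MaxI A))"
  using hat_valuation
  by (auto simp: mv_hom_def fuzzy_def unit_valuation_def mv_hat_def restrict_def fun_eq_iff PiE_iff
      extensional_def)

end

section \<open>Limit cuts and squeezed functions\<close>

lemma carrier_restrict [simp]: "carrier (mv_restrict A S) = S"
  and plus_restrict [simp]: "x \<oplus>\<^bsub>mv_restrict A S\<^esub> y = x \<oplus>\<^bsub>A\<^esub> y"
  and neg_restrict [simp]: "\<sim>\<^bsub>mv_restrict A S\<^esub> x = \<sim>\<^bsub>A\<^esub> x"
  and zero_restrict [simp]: "\<zero>\<^bsub>mv_restrict A S\<^esub> = \<zero>\<^bsub>A\<^esub>"
  by (simp_all add: mv_restrict_def)

lemma le_restrict [simp]: "x \<sqsubseteq>\<^bsub>mv_order (mv_restrict A S)\<^esub> y \<longleftrightarrow> x \<sqsubseteq>\<^bsub>mv_order A\<^esub> y"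
  by (simp add: mv_order_def)

lemma subalgebra_mv_algebra:
  assumes "mv_algebra A" "mv_subalgebra S A"
  shows "mv_algebra (mv_restrict A S)"
proof -
  interpret mv_algebra A by fact
  have S: "\<And>x. x \<in> S \<Longrightarrow> x \<in> carrier A"
    using assms(2) by (auto simp: mv_subalgebra_def)
  show ?thesis
    by unfold_locales
      (use assms(2) in \<open>auto simp: S mv_subalgebra_def intro: plus_assoc plus_comm lukasiewicz\<close>)
qed

lemma carrier_mv_order [simp]: "carrier (mv_order A) = carrier A"
  by (simp add: mv_order_def)

lemma carrier_fuzzy: "carrier (fuzzy X) = X \<rightarrow>\<^sub>E {0..1}"
  by (simp add: fuzzy_def)

lemma evaluation_valuation:
  assumes "S \<subseteq> carrier (fuzzy X)" "x \<in> X"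
  shows "unit_valuation (mv_restrict (fuzzy X) S) (\<lambda>p. p x)"
proof -
  have "0 \<le> p x \<and> p x \<le> 1" if "p \<in> S" for p
    using that assms by (auto simp: carrier_fuzzy PiE_iff dest!: subsetD)
  then show ?thesis
    using assms(2) by (auto simp: unit_valuation_def fuzzy_def)
qed

lemma fuzzy_eqI:
  assumes "p \<in> carrier (fuzzy X)" "q \<in> carrier (fuzzy X)" "\<And>x. x \<in> X \<Longrightarrow> p x = q x"
  shows "p = q"
  using assms by (intro extensionalityI[of p X q]) (auto simp: carrier_fuzzy PiE_iff)

context mv_algebra
begin

lemma hat_closed [simp, intro]: "a \<in> carrier A \<Longrightarrow> mv_hat A a \<in> carrier (fuzzy (MaxI A))"
  using hat_hom by (auto simp: mv_hom_def)

text \<open>The infimum is formed in the full cube over \<open>MaxI A\<close>, which contains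
  functions supported at one point; it can therefore be tested separately at each
  \<open>M\<close>.\<close>

lemma limit_cut_iff:
  "limit_cut A Z \<longleftrightarrow> mv_cut A Z \<and>
    (\<forall>M\<in>MaxI A. \<forall>\<epsilon>>0. \<exists>a\<in>Z. \<exists>b\<in>Upper (mv_order A) Z. mv_hat A b M - mv_hat A a M < \<epsilon>)"
proof -
  define F where "F = fuzzy (MaxI A)"
  define U where "U = Upper (mv_order A) Z"
  define G where "G = {mv_hat A b \<odot>\<^bsub>F\<^esub> \<sim>\<^bsub>F\<^esub> (mv_hat A a) | b a. b \<in> U \<and> a \<in> Z}"
  interpret F: mv_algebra F
    unfolding F_def by (rule fuzzy_mv_algebra)
  have "greatest (mv_order F) \<zero>\<^bsub>F\<^esub> (Lower (mv_order F) G) \<longleftrightarrow>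
      (\<forall>M\<in>MaxI A. \<forall>\<epsilon>>0. \<exists>a\<in>Z. \<exists>b\<in>U. mv_hat A b M - mv_hat A a M < \<epsilon>)"
    if "mv_cut A Z"
  proof -
    have c: "a \<in> carrier A" "b \<in> carrier A" if "a \<in> Z" "b \<in> U" for a b
      using that \<open>mv_cut A Z\<close> by (auto simp: mv_cut_def U_def Upper_def)
    have hatF: "mv_hat A a \<in> carrier F" if "a \<in> carrier A" for a
      using that unfolding F_def by blast
    have G: "G \<subseteq> carrier F"
      using c hatF by (auto simp: G_def)
    have val: "(mv_hat A b \<odot>\<^bsub>F\<^esub> \<sim>\<^bsub>F\<^esub> (mv_hat A a)) M = max 0 (mv_hat A b M - mv_hat A a M)"
      if "a \<in> Z" "b \<in> U" "M \<in> MaxI A" for a b M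
    proof -
      have "\<sim>\<^bsub>F\<^esub> (mv_hat A a) \<in> carrier (fuzzy (MaxI A))" "mv_hat A b \<in> carrier (fuzzy (MaxI A))"
        using that c hatF F.neg_closed unfolding F_def by auto
      then show ?thesis
        using that unfolding F_def by (simp add: fuzzy_times) (simp add: fuzzy_def)
    qed
    have leF: "p \<sqsubseteq>\<^bsub>mv_order F\<^esub> q \<longleftrightarrow> (\<forall>M\<in>MaxI A. p M \<le> q M)"
      if "p \<in> carrier F" "q \<in> carrier F" for p q
      using that fuzzy_le unfolding F_def by blast
    have zeroF: "\<zero>\<^bsub>F\<^esub> M = 0" if "M \<in> MaxI A" for M
      using that by (simp add: F_def fuzzy_def)
    have lower: "p \<in> Lower (mv_order F) G \<longleftrightarrow>
        p \<in> carrier F \<and> (\<forall>a\<in>Z. \<forall>b\<in>U. \<forall>M\<in>MaxI A. p M \<le> max 0 (mv_hat A b M - mv_hat A a M))" for p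
    proof -
      have "p \<in> Lower (mv_order F) G \<longleftrightarrow> p \<in> carrier F \<and> (\<forall>g\<in>G. p \<sqsubseteq>\<^bsub>mv_order F\<^esub> g)"
        using G by (auto simp: Lower_def)
      also have "\<dots> \<longleftrightarrow> p \<in> carrier F \<and> (\<forall>g\<in>G. \<forall>M\<in>MaxI A. p M \<le> g M)"
        using G leF by blast
      also have "\<dots> \<longleftrightarrow> p \<in> carrier F \<and>
          (\<forall>a\<in>Z. \<forall>b\<in>U. \<forall>M\<in>MaxI A. p M \<le> (mv_hat A b \<odot>\<^bsub>F\<^esub> \<sim>\<^bsub>F\<^esub> (mv_hat A a)) M)"
        unfolding G_def by blast
      also have "\<dots> \<longleftrightarrow> p \<in> carrier F \<and>
          (\<forall>a\<in>Z. \<forall>b\<in>U. \<forall>M\<in>MaxI A. p M \<le> max 0 (mv_hat A b M - mv_hat A a M))"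
        using val by (metis (no_types, lifting))
      finally show ?thesis .
    qed
    have "greatest (mv_order F) \<zero>\<^bsub>F\<^esub> (Lower (mv_order F) G) \<longleftrightarrow>
        (\<forall>p\<in>Lower (mv_order F) G. \<forall>M\<in>MaxI A. p M \<le> 0)"
      using lower leF zeroF by (auto simp: greatest_def)
    also have "\<dots> \<longleftrightarrow> (\<forall>M\<in>MaxI A. \<forall>\<epsilon>>0. \<exists>a\<in>Z. \<exists>b\<in>U. mv_hat A b M - mv_hat A a M < \<epsilon>)"
    proof (intro iffI ballI allI impI)
      fix M and \<epsilon> :: real
      assume L: "\<forall>p\<in>Lower (mv_order F) G. \<forall>M\<in>MaxI A. p M \<le> 0" and M: "M \<in> MaxI A" and "\<epsilon> > 0"
      show "\<exists>a\<in>Z. \<exists>b\<in>U. mv_hat A b M - mv_hat A a M < \<epsilon>"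
      proof (rule ccontr)
        assume far: "\<not> ?thesis"
        \<comment> \<open>If all gaps at \<open>M\<close> are at least \<open>\<epsilon>\<close>,
          this function concentrated at \<open>M\<close> is a nonzero lower bound. The cap at 1
          keeps it in the cube when \<open>\<epsilon>\<close> exceeds 1.\<close>
        define p where "p = (\<lambda>N\<in>MaxI A. if N = M then min 1 \<epsilon> else 0)"
        have "p \<in> carrier F"
          using \<open>\<epsilon> > 0\<close> by (auto simp: p_def F_def carrier_fuzzy)
        moreover have "p N \<le> max 0 (mv_hat A b N - mv_hat A a N)"
          if "a \<in> Z" "b \<in> U" "N \<in> MaxI A" for a b N
        proof -
          have "\<epsilon> \<le> mv_hat A b M - mv_hat A a M"
            using far that by (meson not_le)
          then show ?thesis
            using that by (auto simp: p_def)
        qed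
        ultimately have "p M \<le> 0"
          using L M lower by blast
        then show False
          using \<open>\<epsilon> > 0\<close> M by (simp add: p_def)
      qed
    next
      fix p M assume lim: "\<forall>M\<in>MaxI A. \<forall>\<epsilon>>0. \<exists>a\<in>Z. \<exists>b\<in>U. mv_hat A b M - mv_hat A a M < \<epsilon>"
        and p: "p \<in> Lower (mv_order F) G" and M: "M \<in> MaxI A"
      show "p M \<le> 0"
      proof (rule ccontr)
        assume "\<not> p M \<le> 0"
        then obtain a b where "a \<in> Z" "b \<in> U" "mv_hat A b M - mv_hat A a M < p M"
          using lim M by (meson not_le)
        moreover have "p M \<le> max 0 (mv_hat A b M - mv_hat A a M)"
          using p M \<open>a \<in> Z\<close> \<open>b \<in> U\<close> lower by blast
        ultimately show False
          using \<open>\<not> p M \<le> 0\<close> by linarith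
      qed
    qed
    finally show ?thesis .
  qed
  then show ?thesis
    unfolding limit_cut_def Let_def F_def[symmetric] U_def[symmetric] G_def[symmetric] by blast
qed

end

lemma semisimple_mv_algebra: "semisimple A \<Longrightarrow> mv_algebra A"
  by (simp add: semisimple_def)

text \<open>The inequality says that \<open>a \<ominus> b\<close> is zero, and semisimplicity tests
  this in each maximal ideal.\<close>

lemma semisimple_le_iff:
  assumes ss: "semisimple A" and c: "a \<in> carrier A" "b \<in> carrier A"
  shows "a \<sqsubseteq>\<^bsub>mv_order A\<^esub> b \<longleftrightarrow> (\<forall>M\<in>MaxI A. mv_hat A a M \<le> mv_hat A b M)"
proof -
  interpret mv_algebra A
    using ss by (rule semisimple_mv_algebra)
  have "a \<sqsubseteq>\<^bsub>mv_order A\<^esub> b \<longleftrightarrow> a \<ominus> b = \<zero>\<^bsub>A\<^esub>"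
    using c by (simp add: le_iff diff_eq_zero)
  also have "\<dots> \<longleftrightarrow> (\<forall>M\<in>MaxI A. a \<ominus> b \<in> M)"
  proof -
    have "carrier A \<inter> \<Inter> (MaxI A) = {\<zero>\<^bsub>A\<^esub>}"
      using ss by (simp add: semisimple_def)
    then show ?thesis
      using c closed(5) by blast
  qed
  also have "\<dots> \<longleftrightarrow> (\<forall>M\<in>MaxI A. mv_hat A (a \<ominus> b) M = 0)"
    using c by (simp add: hat_zero_iff)
  also have "\<dots> \<longleftrightarrow> (\<forall>M\<in>MaxI A. mv_hat A a M \<le> mv_hat A b M)"
    using c unit_valuation_diff[OF hat_valuation] by (auto simp: max_def)
  finally show ?thesis .
qed

lemma semisimple_eqI:
  assumes ss: "semisimple A" and c: "a \<in> carrier A" "b \<in> carrier A"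
    and eq: "\<And>M. M \<in> MaxI A \<Longrightarrow> mv_hat A a M = mv_hat A b M"
  shows "a = b"
proof -
  interpret mv_algebra A
    using ss by (rule semisimple_mv_algebra)
  show ?thesis
    using semisimple_le_iff[OF ss] c eq le_antisym[of a b] by (simp add: le_iff)
qed

text \<open>The lower approximations of \<open>f\<close> form a limit cut of \<open>D\<close>, and its supremum represents \<open>f\<close>.\<close>

lemma limit_cut_complete_represents:
  assumes D: "limit_cut_complete D"
    and ev: "\<And>x. x \<in> X \<Longrightarrow> unit_valuation D (\<lambda>d. ev d x)"
    and refl: "\<And>d e. \<lbrakk>d \<in> carrier D; e \<in> carrier D; \<And>x. x \<in> X \<Longrightarrow> ev d x \<le> ev e x\<rbrakk>
      \<Longrightarrow> d \<sqsubseteq>\<^bsub>mv_order D\<^esub> e"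
    and P: "P \<subseteq> carrier D"
    and pts: "\<And>N. N \<in> MaxI D \<Longrightarrow> \<exists>x\<in>X. \<forall>d\<in>P. mv_hat D d N = ev d x"
    and f: "\<And>x \<epsilon>. \<lbrakk>x \<in> X; \<epsilon> > 0\<rbrakk> \<Longrightarrow>
      \<exists>a\<in>P. \<exists>b\<in>P. (\<forall>y\<in>X. ev a y \<le> f y \<and> f y \<le> ev b y) \<and> ev b x - ev a x < (\<epsilon>::real)"
  obtains s where "s \<in> carrier D" "\<And>x. x \<in> X \<Longrightarrow> ev s x = f x"
proof -
  interpret mv_algebra D
    using D by (simp add: limit_cut_complete_def semisimple_def)
  have ord: "d \<sqsubseteq>\<^bsub>mv_order D\<^esub> e \<longleftrightarrow> (\<forall>x\<in>X. ev d x \<le> ev e x)"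
    if c: "d \<in> carrier D" "e \<in> carrier D" for d e
    using refl[OF c] unit_valuation_mono[OF ev c] by (auto simp: le_iff)
  define Z where "Z = {d \<in> carrier D. \<forall>x\<in>X. ev d x \<le> f x}"
  define U where "U = {d \<in> carrier D. \<forall>x\<in>X. f x \<le> ev d x}"
  have upper: "Upper (mv_order D) Z = U"
  proof -
    have "f x \<le> ev d x" if d: "d \<in> carrier D" "\<forall>a\<in>Z. a \<sqsubseteq>\<^bsub>mv_order D\<^esub> d" and x: "x \<in> X" for d x
    proof (rule field_le_epsilon)
      fix \<epsilon> :: real assume "\<epsilon> > 0"
      then obtain a b where ab: "a \<in> P" "\<forall>y\<in>X. ev a y \<le> f y \<and> f y \<le> ev b y" "ev b x - ev a x < \<epsilon>"
        using f x by meson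
      then have "a \<in> Z"
        using P by (auto simp: Z_def)
      then have "ev a x \<le> ev d x"
        using d x ord by (auto simp: Z_def)
      then show "f x \<le> ev d x + \<epsilon>"
        using ab x by fastforce
    qed
    moreover have "a \<sqsubseteq>\<^bsub>mv_order D\<^esub> d" if "a \<in> Z" "d \<in> U" for a d
      using that ord by (force simp: Z_def U_def)
    ultimately show ?thesis
      unfolding Upper_def by (fastforce simp: U_def Z_def)
  qed
  have lower: "Lower (mv_order D) U = Z"
  proof -
    have "ev d x \<le> f x" if d: "d \<in> carrier D" "\<forall>b\<in>U. d \<sqsubseteq>\<^bsub>mv_order D\<^esub> b" and x: "x \<in> X" for d x
    proof (rule field_le_epsilon)
      fix \<epsilon> :: real assume "\<epsilon> > 0"
      then obtain a b where ab: "b \<in> P" "\<forall>y\<in>X. ev a y \<le> f y \<and> f y \<le> ev b y" "ev b x - ev a x < \<epsilon>"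
        using f x by meson
      then have "b \<in> U"
        using P by (auto simp: U_def)
      then have "ev d x \<le> ev b x"
        using d x ord by (auto simp: U_def)
      then show "ev d x \<le> f x + \<epsilon>"
        using ab x by fastforce
    qed
    moreover have "a \<sqsubseteq>\<^bsub>mv_order D\<^esub> d" if "a \<in> Z" "d \<in> U" for a d
      using that ord by (force simp: Z_def U_def)
    ultimately show ?thesis
      unfolding Lower_def by (fastforce simp: U_def Z_def)
  qed
  have "limit_cut D Z"
    unfolding limit_cut_iff upper
  proof (intro conjI ballI allI impI)
    have "Z \<subseteq> carrier D"
      by (auto simp: Z_def)
    then show "mv_cut D Z"
      by (simp add: mv_cut_def upper lower)
    \<comment> \<open>\<open>N\<close> need not be evaluation at a point of \<open>X\<close>, but on
      \<open>P\<close> it agrees with one. Since the approximants \<open>a\<close> and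
      \<open>b\<close> come from \<open>P\<close>, their gap at \<open>N\<close> equals their gap at
      \<open>x\<close>.\<close>
    fix N and \<epsilon> :: real assume "N \<in> MaxI D" "\<epsilon> > 0"
    then obtain x where x: "x \<in> X" "\<forall>d\<in>P. mv_hat D d N = ev d x"
      using pts by blast
    obtain a b where ab: "a \<in> P" "b \<in> P" "\<forall>y\<in>X. ev a y \<le> f y \<and> f y \<le> ev b y"
      "ev b x - ev a x < \<epsilon>"
      using f[OF x(1) \<open>\<epsilon> > 0\<close>] by blast
    then have "a \<in> Z" "b \<in> U"
      using P by (auto simp: Z_def U_def)
    then show "\<exists>a\<in>Z. \<exists>b\<in>U. mv_hat D b N - mv_hat D a N < \<epsilon>"
      using ab x by (intro bexI[of _ a] bexI[of _ b]) auto
  qed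
  then obtain s where s: "least (mv_order D) s U"
    using D upper by (auto simp: limit_cut_complete_def)
  then have sU: "s \<in> U" and least: "\<And>b. b \<in> U \<Longrightarrow> s \<sqsubseteq>\<^bsub>mv_order D\<^esub> b"
    by (auto simp: least_def)
  \<comment> \<open>Membership in \<open>U\<close> puts \<open>s\<close> above \<open>f\<close>;
    being a lower bound of \<open>U\<close> puts it in \<open>Z\<close>, below \<open>f\<close>. The
    cut equation thus gives equality at every point, although suprema in \<open>D\<close> need not
    be pointwise.\<close>
  then have "s \<in> Lower (mv_order D) U"
    by (auto simp: Lower_def U_def)
  then have "s \<in> Z"
    by (simp add: lower)
  then show thesis
    using sU that[of s] by (force simp: Z_def U_def)
qed

section \<open>Functions squeezed between elements of a subalgebra\<close>

definition squeezed :: "'x set \<Rightarrow> ('x \<Rightarrow> real) set \<Rightarrow> ('x \<Rightarrow> real) set"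
  where "squeezed X P = {f \<in> carrier (fuzzy X). \<forall>x\<in>X. \<forall>\<epsilon>>0. \<exists>a\<in>P. \<exists>b\<in>P.
    (\<forall>y\<in>X. a y \<le> f y \<and> f y \<le> b y) \<and> b x - a x < \<epsilon>}"

lemma squeezedE:
  assumes "f \<in> squeezed X P" "x \<in> X" "\<epsilon> > 0"
  obtains a b where "a \<in> P" "b \<in> P" "\<And>y. y \<in> X \<Longrightarrow> a y \<le> f y" "\<And>y. y \<in> X \<Longrightarrow> f y \<le> b y"
    "b x - a x < \<epsilon>"
  using assms unfolding squeezed_def by blast

lemma squeezed_fuzzy: "squeezed X P \<subseteq> carrier (fuzzy X)"
  by (auto simp: squeezed_def)

lemma subset_squeezed: "P \<subseteq> carrier (fuzzy X) \<Longrightarrow> P \<subseteq> squeezed X P"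
  by (force simp: squeezed_def)

lemma squeezed_subalgebra:
  assumes P: "mv_subalgebra P (fuzzy X)"
  shows "mv_subalgebra (squeezed X P) (fuzzy X)"
proof -
  interpret F: mv_algebra "fuzzy X"
    by (rule fuzzy_mv_algebra)
  have neg: "(\<sim>\<^bsub>fuzzy X\<^esub> p) x = 1 - p x" and plus: "(p \<oplus>\<^bsub>fuzzy X\<^esub> q) x = min 1 (p x + q x)"
    if "x \<in> X" for p q :: "'a \<Rightarrow> real" and x
    using that by (simp_all add: fuzzy_def)
  show ?thesis
    unfolding mv_subalgebra_def
  proof (intro conjI ballI)
    show "squeezed X P \<subseteq> carrier (fuzzy X)"
      by (rule squeezed_fuzzy)
    show "\<zero>\<^bsub>fuzzy X\<^esub> \<in> squeezed X P"
      using P subset_squeezed by (auto simp: mv_subalgebra_def)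
    fix f assume f: "f \<in> squeezed X P"
    show "\<sim>\<^bsub>fuzzy X\<^esub> f \<in> squeezed X P"
      unfolding squeezed_def
    proof (intro CollectI conjI ballI allI impI)
      show "\<sim>\<^bsub>fuzzy X\<^esub> f \<in> carrier (fuzzy X)"
        using f squeezed_fuzzy by blast
      fix x and \<epsilon> :: real assume "x \<in> X" "\<epsilon> > 0"
      obtain a b where "a \<in> P" "b \<in> P" "\<And>y. y \<in> X \<Longrightarrow> a y \<le> f y"
        "\<And>y. y \<in> X \<Longrightarrow> f y \<le> b y" "b x - a x < \<epsilon>"
        using f \<open>x \<in> X\<close> \<open>\<epsilon> > 0\<close> by (rule squeezedE) blast
      then show "\<exists>a\<in>P. \<exists>b\<in>P. (\<forall>y\<in>X. a y \<le> (\<sim>\<^bsub>fuzzy X\<^esub> f) y \<and> (\<sim>\<^bsub>fuzzy X\<^esub> f) y \<le> b y) \<and> b x - a x < \<epsilon>"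
        using P \<open>x \<in> X\<close>
        by (intro bexI[of _ "\<sim>\<^bsub>fuzzy X\<^esub> b"] bexI[of _ "\<sim>\<^bsub>fuzzy X\<^esub> a"]) (auto simp: neg mv_subalgebra_def)
    qed
    fix g assume g: "g \<in> squeezed X P"
    show "f \<oplus>\<^bsub>fuzzy X\<^esub> g \<in> squeezed X P"
      unfolding squeezed_def
    proof (intro CollectI conjI ballI allI impI)
      show "f \<oplus>\<^bsub>fuzzy X\<^esub> g \<in> carrier (fuzzy X)"
        using f g squeezed_fuzzy by blast
      fix x and \<epsilon> :: real assume x: "x \<in> X" and "\<epsilon> > 0"
      then have "\<epsilon> / 2 > 0"
        by simp
      obtain a b where ab: "a \<in> P" "b \<in> P" "\<And>y. y \<in> X \<Longrightarrow> a y \<le> f y"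
        "\<And>y. y \<in> X \<Longrightarrow> f y \<le> b y" "b x - a x < \<epsilon> / 2"
        using f x \<open>\<epsilon> / 2 > 0\<close> by (rule squeezedE) blast
      obtain a' b' where ab': "a' \<in> P" "b' \<in> P" "\<And>y. y \<in> X \<Longrightarrow> a' y \<le> g y"
        "\<And>y. y \<in> X \<Longrightarrow> g y \<le> b' y" "b' x - a' x < \<epsilon> / 2"
        using g x \<open>\<epsilon> / 2 > 0\<close> by (rule squeezedE) blast
      have "min 1 (a y + a' y) \<le> min 1 (f y + g y) \<and> min 1 (f y + g y) \<le> min 1 (b y + b' y)"
        if "y \<in> X" for y
        using ab(3,4)[OF that] ab'(3,4)[OF that] by linarith
      moreover have "min 1 (b x + b' x) - min 1 (a x + a' x) < \<epsilon>"
        using ab(3,4)[OF x] ab'(3,4)[OF x] ab(5) ab'(5) \<open>\<epsilon> > 0\<close> by linarith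
      ultimately show "\<exists>a\<in>P. \<exists>b\<in>P. (\<forall>y\<in>X. a y \<le> (f \<oplus>\<^bsub>fuzzy X\<^esub> g) y \<and> (f \<oplus>\<^bsub>fuzzy X\<^esub> g) y \<le> b y) \<and> b x - a x < \<epsilon>"
        using P x ab(1,2) ab'(1,2)
        by (intro bexI[of _ "a \<oplus>\<^bsub>fuzzy X\<^esub> a'"] bexI[of _ "b \<oplus>\<^bsub>fuzzy X\<^esub> b'"])
          (simp_all add: plus mv_subalgebra_def)
    qed
  qed
qed

text \<open>Each point \<open>x\<close> yields the maximal ideal \<open>K x\<close>, at which
  \<open>mv_hat\<close> is evaluation at \<open>x\<close>. This gives semisimplicity and turns the
  limit condition into small gaps at every point, so the pointwise supremum of a limit cut is
  squeezed again.\<close>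

lemma squeezed_limit_cut_complete:
  assumes P: "mv_subalgebra P (fuzzy X)"
  shows "limit_cut_complete (mv_restrict (fuzzy X) (squeezed X P))" (is "limit_cut_complete ?S")
proof -
  interpret S: mv_algebra ?S
    using P by (intro subalgebra_mv_algebra fuzzy_mv_algebra squeezed_subalgebra)
  have ev: "unit_valuation ?S (\<lambda>p. p x)" if "x \<in> X" for x
    using that squeezed_fuzzy by (rule evaluation_valuation[rotated])
  define K where "K = (\<lambda>x. {p \<in> carrier ?S. p x = 0})"
  have K: "K x \<in> MaxI ?S" if "x \<in> X" for x
    unfolding K_def using ev[OF that] by (rule S.kernel_maximal)
  have hatK: "mv_hat ?S p (K x) = p x" if "x \<in> X" "p \<in> carrier ?S" for x p
    unfolding K_def using ev that by (intro S.hat_kernel)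
  have fz: "p \<in> carrier (fuzzy X)" if "p \<in> squeezed X P" for p
    using that squeezed_fuzzy by blast
  have ord: "p \<sqsubseteq>\<^bsub>mv_order ?S\<^esub> q \<longleftrightarrow> (\<forall>x\<in>X. p x \<le> q x)" if "p \<in> squeezed X P" "q \<in> squeezed X P" for p q
    using that by (simp add: fuzzy_le fz)
  have semi: "semisimple ?S"
    unfolding semisimple_def
  proof (intro conjI equalityI subsetI)
    show "mv_algebra ?S"
      by (rule S.mv_algebra_axioms)
    fix p assume p: "p \<in> carrier ?S \<inter> \<Inter> (MaxI ?S)"
    then have "p x = 0" if "x \<in> X" for x
      using K[OF that] by (auto simp: K_def)
    moreover have "\<zero>\<^bsub>fuzzy X\<^esub> x = 0" if "x \<in> X" for x
      using that by (simp add: fuzzy_def)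
    ultimately have "p = \<zero>\<^bsub>fuzzy X\<^esub>"
      using p fz mv_algebra.zero_closed[OF fuzzy_mv_algebra, of X] by (intro fuzzy_eqI[of _ X]) auto
    then show "p \<in> {\<zero>\<^bsub>?S\<^esub>}"
      by simp
  qed (use S.zero_closed in \<open>auto simp: MaxI_def mv_ideal_def\<close>)
  have "\<exists>s. least (mv_order ?S) s (Upper (mv_order ?S) Z)" if Z: "limit_cut ?S Z" for Z
  proof -
    define U where "U = Upper (mv_order ?S) Z"
    have ZS: "Z \<subseteq> squeezed X P"
      using Z by (auto simp: limit_cut_def mv_cut_def)
    have US: "U \<subseteq> squeezed X P"
      by (auto simp: U_def Upper_def)
    have ZU: "a x \<le> b x" if "a \<in> Z" "b \<in> U" "x \<in> X" for a b x
    proof -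
      have "a \<sqsubseteq>\<^bsub>mv_order ?S\<^esub> b"
        using that ZS unfolding U_def Upper_def by auto
      then show ?thesis
        using that ZS US ord by blast
    qed
    have lim: "\<exists>a\<in>Z. \<exists>b\<in>U. b x - a x < \<epsilon>" if x: "x \<in> X" "\<epsilon> > 0" for x \<epsilon>
    proof -
      obtain a b where "a \<in> Z" "b \<in> U" "mv_hat ?S b (K x) - mv_hat ?S a (K x) < \<epsilon>"
        using Z K[OF x(1)] x(2) unfolding S.limit_cut_iff U_def by blast
      then show ?thesis
        using hatK x(1) ZS US by (metis carrier_restrict subsetD)
    qed
    define f where "f = (\<lambda>x\<in>X. SUP a\<in>Z. a x)"
    \<comment> \<open>The limit condition with gap 1 at a point excludes an empty \<open>Z\<close>
      or \<open>U\<close>, so the suprema that define \<open>f\<close> are over nonempty sets, and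
      \<open>U\<close> bounds them.\<close>
    have ne: "Z \<noteq> {}" "U \<noteq> {}" if "x \<in> X" for x
      using lim[OF that zero_less_one] by auto
    have bdd: "bdd_above ((\<lambda>a. a x) ` Z)" if x: "x \<in> X" for x
    proof -
      obtain b where "b \<in> U"
        using ne(2)[OF x] by blast
      then show ?thesis
        using ZU x by (intro bdd_aboveI2[of Z _ "b x"]) auto
    qed
    have Zf: "a x \<le> f x" if "a \<in> Z" "x \<in> X" for a x
      using that bdd by (auto simp: f_def intro!: cSUP_upper)
    have fU: "f x \<le> b x" if "b \<in> U" "x \<in> X" for b x
      using that ne ZU by (auto simp: f_def intro!: cSUP_least)
    have "f \<in> carrier (fuzzy X)"
    proof -
      have "0 \<le> f x \<and> f x \<le> 1" if x: "x \<in> X" for x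
      proof -
        obtain a b where ab: "a \<in> Z" "b \<in> U"
          using ne[OF x] by blast
        then have "0 \<le> a x" "b x \<le> 1"
          using ZS US fz x by (fastforce simp: carrier_fuzzy)+
        then show ?thesis
          using Zf[OF ab(1) x] fU[OF ab(2) x] by linarith
      qed
      then show ?thesis
        by (auto simp: carrier_fuzzy f_def)
    qed
    moreover have "\<exists>a\<in>P. \<exists>b\<in>P. (\<forall>y\<in>X. a y \<le> f y \<and> f y \<le> b y) \<and> b x - a x < \<epsilon>"
      if x: "x \<in> X" and "\<epsilon> > 0" for x \<epsilon>
    proof -
      have \<epsilon>: "\<epsilon> / 3 > 0"
        using \<open>\<epsilon> > 0\<close> by simp
      obtain a b where ab: "a \<in> Z" "b \<in> U" "b x - a x < \<epsilon> / 3"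
        using lim[OF x \<epsilon>] by blast
      have "a \<in> squeezed X P" "b \<in> squeezed X P"
        using ab ZS US by blast+
      \<comment> \<open>The new bounds are the lower approximant \<open>a'\<close> of
        \<open>a\<close> and the upper approximant \<open>b''\<close> of \<open>b\<close>; the
        thirds pay for passing from \<open>a'\<close> to \<open>a\<close>, from \<open>a\<close> to
        \<open>b\<close> and from \<open>b\<close> to \<open>b''\<close>.\<close>
      then obtain a' a'' b' b'' where
        a': "a' \<in> P" "\<And>y. y \<in> X \<Longrightarrow> a' y \<le> a y" "\<And>y. y \<in> X \<Longrightarrow> a y \<le> a'' y" "a'' x - a' x < \<epsilon> / 3"
        and b': "b'' \<in> P" "\<And>y. y \<in> X \<Longrightarrow> b' y \<le> b y" "\<And>y. y \<in> X \<Longrightarrow> b y \<le> b'' y" "b'' x - b' x < \<epsilon> / 3"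
        using x \<epsilon> by (metis squeezedE)
      have "a' y \<le> f y \<and> f y \<le> b'' y" if "y \<in> X" for y
        using a'(2)[OF that] b'(3)[OF that] Zf[OF ab(1) that] fU[OF ab(2) that] by linarith
      moreover have "b'' x - a' x < \<epsilon>"
        using ab(3) a'(3)[OF x] a'(4) b'(2)[OF x] b'(4) by linarith
      ultimately show ?thesis
        using a'(1) b'(1) by blast
    qed
    ultimately have fS: "f \<in> squeezed X P"
      by (simp add: squeezed_def)
    have "f \<in> U"
      using fS ZS Zf ord by (auto simp: U_def Upper_def)
    moreover have "f \<sqsubseteq>\<^bsub>mv_order ?S\<^esub> b" if "b \<in> U" for b
      using that fS US fU ord by blast
    moreover have "U \<subseteq> carrier (mv_order ?S)"
      using US by simp
    ultimately show ?thesis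
      unfolding U_def[symmetric] least_def by blast
  qed
  then show ?thesis
    using semi by (simp add: limit_cut_complete_def)
qed

section \<open>The limit cut completion as a reflector\<close>

definition hats :: "'a mv \<Rightarrow> ('a set \<Rightarrow> real) set"
  where "hats A = mv_hat A ` carrier A"

context mv_algebra
begin

lemma hat_plus: "\<lbrakk>a \<in> carrier A; b \<in> carrier A\<rbrakk> \<Longrightarrow>
    mv_hat A (a \<oplus> b) = mv_hat A a \<oplus>\<^bsub>fuzzy (MaxI A)\<^esub> mv_hat A b"
  and hat_neg: "a \<in> carrier A \<Longrightarrow> mv_hat A (\<sim> a) = \<sim>\<^bsub>fuzzy (MaxI A)\<^esub> (mv_hat A a)"
  and hat_zero: "mv_hat A \<zero> = \<zero>\<^bsub>fuzzy (MaxI A)\<^esub>"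
  using hat_hom by (auto simp: mv_hom_def)

lemma hats_subalgebra: "mv_subalgebra (hats A) (fuzzy (MaxI A))"
  unfolding mv_subalgebra_def
proof (intro conjI ballI)
  show "hats A \<subseteq> carrier (fuzzy (MaxI A))"
    by (auto simp: hats_def)
  show "\<zero>\<^bsub>fuzzy (MaxI A)\<^esub> \<in> hats A"
    unfolding hats_def hat_zero[symmetric] by blast
  fix p assume "p \<in> hats A"
  then obtain a where a: "a \<in> carrier A" "p = mv_hat A a"
    by (auto simp: hats_def)
  then show "\<sim>\<^bsub>fuzzy (MaxI A)\<^esub> p \<in> hats A"
    using hat_neg[symmetric] by (auto simp: hats_def)
  fix q assume "q \<in> hats A"
  then obtain b where "b \<in> carrier A" "q = mv_hat A b"
    by (auto simp: hats_def)
  then show "p \<oplus>\<^bsub>fuzzy (MaxI A)\<^esub> q \<in> hats A"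
    using a hat_plus[symmetric] by (auto simp: hats_def)
qed

text \<open>A maximal ideal \<open>N\<close> of \<open>?D\<close> pulls back along
  \<open>mv_hat A\<close> to a maximal ideal of \<open>A\<close>, and on \<open>hats A\<close> the
  value at \<open>N\<close> is evaluation at that ideal. Hence the bounds from \<open>hats A\<close>
  certify a limit cut of \<open>?D\<close>, whose supremum is \<open>f\<close>.\<close>

lemma squeezed_subset_completion:
  assumes S: "mv_subalgebra S (fuzzy (MaxI A))" "hats A \<subseteq> S"
    and lcc: "limit_cut_complete (mv_restrict (fuzzy (MaxI A)) S)" (is "limit_cut_complete ?D")
  shows "squeezed (MaxI A) (hats A) \<subseteq> S"
proof
  fix f assume f: "f \<in> squeezed (MaxI A) (hats A)"
  interpret D: mv_algebra ?D
    using S by (intro subalgebra_mv_algebra fuzzy_mv_algebra)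
  have SF: "S \<subseteq> carrier (fuzzy (MaxI A))"
    using S by (simp add: mv_subalgebra_def)
  have hatD: "mv_hat A \<in> mv_hom A ?D"
    using hat_hom S(2) by (auto simp: mv_hom_def hats_def PiE_iff)
  obtain s where s: "s \<in> carrier ?D" "\<And>x. x \<in> MaxI A \<Longrightarrow> s x = f x"
  proof (rule limit_cut_complete_represents[OF lcc, of "MaxI A" "\<lambda>p. p" "hats A" f])
    show "unit_valuation ?D (\<lambda>p. p M)" if "M \<in> MaxI A" for M
      using SF that by (rule evaluation_valuation)
    show "p \<sqsubseteq>\<^bsub>mv_order ?D\<^esub> q" if "p \<in> carrier ?D" "q \<in> carrier ?D" "\<And>M. M \<in> MaxI A \<Longrightarrow> p M \<le> q M" for p q
      using that SF by (simp add: fuzzy_le subset_iff)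
    show "hats A \<subseteq> carrier ?D"
      using S by simp
    show "\<exists>M\<in>MaxI A. \<forall>p\<in>hats A. mv_hat ?D p N = p M" if N: "N \<in> MaxI ?D" for N
    proof -
      have val: "unit_valuation A (\<lambda>a. mv_hat ?D (mv_hat A a) N)"
        using D.hat_valuation[OF N] hatD by (rule unit_valuation_compose)
      show ?thesis
      proof (rule bexI)
        show "\<forall>p\<in>hats A. mv_hat ?D p N = p {a \<in> carrier A. mv_hat ?D (mv_hat A a) N = 0}"
          by (simp add: hats_def hat_kernel[OF val])
      qed (rule kernel_maximal[OF val])
    qed
    show "\<exists>a\<in>hats A. \<exists>b\<in>hats A. (\<forall>N\<in>MaxI A. a N \<le> f N \<and> f N \<le> b N) \<and> b M - a M < \<epsilon>"
      if "M \<in> MaxI A" "\<epsilon> > 0" for M \<epsilon>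
      using f that by (simp add: squeezed_def)
  qed blast
  then have "s = f"
    using SF subsetD[OF squeezed_fuzzy f] by (intro fuzzy_eqI[of _ "MaxI A"]) auto
  then show "f \<in> S"
    using s by simp
qed

text \<open>The squeezed functions form one of the intersected subalgebras and lie in all the
  others.\<close>

lemma lcc_eq: "lcc A = mv_restrict (fuzzy (MaxI A)) (squeezed (MaxI A) (hats A))"
proof -
  have "squeezed (MaxI A) (hats A) \<in> {S. mv_subalgebra S (fuzzy (MaxI A)) \<and>
      limit_cut_complete (mv_restrict (fuzzy (MaxI A)) S) \<and> mv_hat A ` carrier A \<subseteq> S}"
    using squeezed_subalgebra[OF hats_subalgebra] squeezed_limit_cut_complete[OF hats_subalgebra]
      subset_squeezed[of "hats A" "MaxI A"] hats_subalgebra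
    by (auto simp: hats_def mv_subalgebra_def)
  then show ?thesis
    unfolding lcc_def using squeezed_subset_completion
    by (intro arg_cong[where f = "mv_restrict _"] equalityI Inter_greatest Inter_lower) (auto simp: hats_def)
qed

lemma lcc_limit_cut_complete: "limit_cut_complete (lcc A)"
  unfolding lcc_eq by (intro squeezed_limit_cut_complete hats_subalgebra)

lemma lcc_mv_algebra: "mv_algebra (lcc A)"
  using lcc_limit_cut_complete semisimple_mv_algebra by (auto simp: limit_cut_complete_def)

lemma lcc_carrier: "carrier (lcc A) = squeezed (MaxI A) (hats A)"
  by (simp add: lcc_eq)

lemma lcc_fuzzy: "p \<in> carrier (lcc A) \<Longrightarrow> p \<in> carrier (fuzzy (MaxI A))"
  using squeezed_fuzzy lcc_carrier by blast

lemma hat_lcc: "a \<in> carrier A \<Longrightarrow> mv_hat A a \<in> carrier (lcc A)"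
  using subset_squeezed[of "hats A" "MaxI A"] by (force simp: lcc_carrier hats_def)

lemma hat_hom_lcc: "mv_hat A \<in> mv_hom A (lcc A)"
  using hat_hom hat_lcc by (auto simp: mv_hom_def lcc_eq PiE_iff)

lemma lccE:
  assumes "p \<in> carrier (lcc A)" "M \<in> MaxI A" "\<epsilon> > 0"
  obtains a b where "a \<in> carrier A" "b \<in> carrier A"
    "\<And>N. N \<in> MaxI A \<Longrightarrow> mv_hat A a N \<le> p N" "\<And>N. N \<in> MaxI A \<Longrightarrow> p N \<le> mv_hat A b N"
    "mv_hat A b M - mv_hat A a M < \<epsilon>"
  using assms unfolding lcc_carrier by (elim squeezedE[OF _ assms(2,3)]) (auto simp: hats_def)

lemma lcc_apply:
  assumes "M \<in> MaxI A"
  shows "(p \<oplus>\<^bsub>lcc A\<^esub> q) M = min 1 (p M + q M)" "(\<sim>\<^bsub>lcc A\<^esub> p) M = 1 - p M" "\<zero>\<^bsub>lcc A\<^esub> M = 0"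
  using assms by (simp_all add: lcc_eq) (simp_all add: fuzzy_def)

text \<open>Squeezing forces every homomorphism from \<open>lcc A\<close> to the unit interval to be an evaluation.\<close>

lemma lcc_valuation:
  assumes h: "unit_valuation (lcc A) h" and p: "p \<in> carrier (lcc A)"
  shows "{a \<in> carrier A. h (mv_hat A a) = 0} \<in> MaxI A" (is "?K \<in> _")
    and "h p = p {a \<in> carrier A. h (mv_hat A a) = 0}"
proof -
  interpret L: mv_algebra "lcc A"
    by (rule lcc_mv_algebra)
  have val: "unit_valuation A (\<lambda>a. h (mv_hat A a))"
    using h hat_hom_lcc by (rule unit_valuation_compose)
  show K: "?K \<in> MaxI A"
    using kernel_maximal[OF val] .
  have le: "h q \<le> h r"
    if c: "q \<in> carrier (lcc A)" "r \<in> carrier (lcc A)" and "\<And>N. N \<in> MaxI A \<Longrightarrow> q N \<le> r N" for q r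
  proof (rule L.unit_valuation_mono[OF h c])
    have "q \<sqsubseteq>\<^bsub>mv_order (fuzzy (MaxI A))\<^esub> r"
      using that lcc_fuzzy by (simp add: fuzzy_le)
    then have "q \<sqsubseteq>\<^bsub>mv_order (lcc A)\<^esub> r"
      by (simp add: lcc_eq)
    then show "L.le q r"
      by (simp add: L.le_iff)
  qed
  have "\<bar>h p - p ?K\<bar> \<le> 0"
  proof (rule field_le_epsilon)
    \<comment> \<open>The bounds are chosen close together at \<open>?K\<close>, where
      \<open>mv_hat A a\<close> and \<open>mv_hat A b\<close> take their \<open>h\<close>-values;
      both \<open>h p\<close> and \<open>p ?K\<close> lie between these.\<close>
    fix \<epsilon> :: real assume "\<epsilon> > 0"
    obtain a b where ab: "a \<in> carrier A" "b \<in> carrier A"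
      "\<And>N. N \<in> MaxI A \<Longrightarrow> mv_hat A a N \<le> p N" "\<And>N. N \<in> MaxI A \<Longrightarrow> p N \<le> mv_hat A b N"
      "mv_hat A b ?K - mv_hat A a ?K < \<epsilon>"
      using p K \<open>\<epsilon> > 0\<close> by (rule lccE) blast
    have "h (mv_hat A a) \<le> h p" "h p \<le> h (mv_hat A b)"
      using ab p hat_lcc by (auto intro!: le)
    moreover have "mv_hat A a ?K = h (mv_hat A a)" "mv_hat A b ?K = h (mv_hat A b)"
      using ab hat_kernel[OF val] by auto
    ultimately show "\<bar>h p - p ?K\<bar> \<le> 0 + \<epsilon>"
      using ab(3,4)[OF K] ab(5) by linarith
  qed
  then show "h p = p ?K"
    by simp
qed

end

section \<open>Action on homomorphisms: functoriality and faithfulness\<close>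

lemma hom_apply:
  assumes "f \<in> mv_hom A B"
  shows "a \<in> carrier A \<Longrightarrow> f a \<in> carrier B" "f \<zero>\<^bsub>A\<^esub> = \<zero>\<^bsub>B\<^esub>"
    "a \<in> carrier A \<Longrightarrow> f (\<sim>\<^bsub>A\<^esub> a) = \<sim>\<^bsub>B\<^esub> (f a)"
    "a \<in> carrier A \<Longrightarrow> b \<in> carrier A \<Longrightarrow> f (a \<oplus>\<^bsub>A\<^esub> b) = f a \<oplus>\<^bsub>B\<^esub> f b"
    "f \<in> extensional (carrier A)"
  using assms by (auto simp: mv_hom_def PiE_iff)

text \<open>The inverse image is the kernel of the valuation that sends \<open>a\<close> to
  \<open>mv_hat B (f a) N\<close>. Kernels of valuations are maximal, and \<open>hat_kernel\<close>
  identifies the values.\<close>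

lemma vimage_maximal:
  assumes A: "mv_algebra A" and B: "mv_algebra B" and f: "f \<in> mv_hom A B" and N: "N \<in> MaxI B"
  shows "f -` N \<inter> carrier A \<in> MaxI A"
    and "a \<in> carrier A \<Longrightarrow> mv_hat A a (f -` N \<inter> carrier A) = mv_hat B (f a) N"
proof -
  interpret A: mv_algebra A by (rule A)
  interpret B: mv_algebra B by (rule B)
  have val: "unit_valuation A (\<lambda>a. mv_hat B (f a) N)"
    using B.hat_valuation[OF N] f by (rule unit_valuation_compose)
  have eq: "f -` N \<inter> carrier A = {a \<in> carrier A. mv_hat B (f a) N = 0}"
    using hom_apply(1)[OF f] B.hat_zero_iff[OF N] by auto
  show "f -` N \<inter> carrier A \<in> MaxI A"
    unfolding eq by (rule A.kernel_maximal[OF val])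
  show "mv_hat A a (f -` N \<inter> carrier A) = mv_hat B (f a) N" if "a \<in> carrier A"
    unfolding eq by (rule A.hat_kernel[OF val that])
qed

lemma lcc_map_apply:
  "\<lbrakk>p \<in> carrier (lcc A); N \<in> MaxI B\<rbrakk> \<Longrightarrow> lcc_map A B f p N = p (f -` N \<inter> carrier A)"
  by (simp add: lcc_map_def)

text \<open>Bounds \<open>a\<close>, \<open>b\<close> for \<open>p\<close>, chosen at the inverse
  image of \<open>N\<close>, are carried by \<open>f\<close> to bounds for the image function with
  the same gap at \<open>N\<close>.\<close>

lemma lcc_map_closed:
  assumes A: "mv_algebra A" and B: "mv_algebra B" and f: "f \<in> mv_hom A B"
    and p: "p \<in> carrier (lcc A)"
  shows "lcc_map A B f p \<in> carrier (lcc B)"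
proof -
  interpret A: mv_algebra A by (rule A)
  interpret B: mv_algebra B by (rule B)
  note vim = vimage_maximal[OF A B f]
  have "0 \<le> p M \<and> p M \<le> 1" if "M \<in> MaxI A" for M
    using A.lcc_fuzzy[OF p] that by (auto simp: carrier_fuzzy PiE_iff)
  then have fz: "lcc_map A B f p \<in> carrier (fuzzy (MaxI B))"
    using vim(1) p by (auto simp: carrier_fuzzy lcc_map_def)
  have "\<exists>a\<in>hats B. \<exists>b\<in>hats B.
      (\<forall>y\<in>MaxI B. a y \<le> lcc_map A B f p y \<and> lcc_map A B f p y \<le> b y) \<and> b N - a N < \<epsilon>"
    if N: "N \<in> MaxI B" and "\<epsilon> > 0" for N \<epsilon>
  proof -
    obtain a b where ab: "a \<in> carrier A" "b \<in> carrier A"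
      "\<And>N. N \<in> MaxI A \<Longrightarrow> mv_hat A a N \<le> p N" "\<And>N. N \<in> MaxI A \<Longrightarrow> p N \<le> mv_hat A b N"
      "mv_hat A b (f -` N \<inter> carrier A) - mv_hat A a (f -` N \<inter> carrier A) < \<epsilon>"
      using p vim(1)[OF N] \<open>\<epsilon> > 0\<close> by (rule A.lccE) blast
    have "mv_hat B (f a) y \<le> lcc_map A B f p y \<and> lcc_map A B f p y \<le> mv_hat B (f b) y"
      if y: "y \<in> MaxI B" for y
      using ab(3,4)[OF vim(1)[OF y]] p y by (simp add: lcc_map_apply vim(2) ab)
    moreover have "mv_hat B (f b) N - mv_hat B (f a) N < \<epsilon>"
      using ab(5) N by (simp add: vim(2) ab)
    moreover have "mv_hat B (f a) \<in> hats B" "mv_hat B (f b) \<in> hats B"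
      using ab hom_apply(1)[OF f] by (auto simp: hats_def)
    ultimately show ?thesis
      by blast
  qed
  then show ?thesis
    using fz unfolding B.lcc_carrier squeezed_def by blast
qed

lemma lcc_eqI:
  assumes A: "mv_algebra A" and "p \<in> carrier (lcc A)" "q \<in> carrier (lcc A)"
    and "\<And>M. M \<in> MaxI A \<Longrightarrow> p M = q M"
  shows "p = q"
  using assms mv_algebra.lcc_fuzzy[OF A] by (intro fuzzy_eqI[of p "MaxI A" q]) auto

lemma lcc_map_hom:
  assumes A: "mv_algebra A" and B: "mv_algebra B" and f: "f \<in> mv_hom A B"
  shows "lcc_map A B f \<in> mv_hom (lcc A) (lcc B)"
proof -
  interpret LA: mv_algebra "lcc A"
    using A by (rule mv_algebra.lcc_mv_algebra)
  interpret LB: mv_algebra "lcc B"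
    using B by (rule mv_algebra.lcc_mv_algebra)
  note cl = lcc_map_closed[OF A B f] and vim = vimage_maximal(1)[OF A B f]
    and app = mv_algebra.lcc_apply[OF A] mv_algebra.lcc_apply[OF B]
  show ?thesis
    unfolding mv_hom_def
  proof (intro CollectI conjI ballI)
    show "lcc_map A B f \<in> carrier (lcc A) \<rightarrow>\<^sub>E carrier (lcc B)"
      using cl by (auto simp: lcc_map_def[of A B f])
    show "lcc_map A B f \<zero>\<^bsub>lcc A\<^esub> = \<zero>\<^bsub>lcc B\<^esub>"
      using cl vim by (intro lcc_eqI[OF B]) (auto simp: lcc_map_apply app)
    fix p assume p: "p \<in> carrier (lcc A)"
    then show "lcc_map A B f (\<sim>\<^bsub>lcc A\<^esub> p) = \<sim>\<^bsub>lcc B\<^esub> (lcc_map A B f p)"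
      using cl vim by (intro lcc_eqI[OF B]) (auto simp: lcc_map_apply app)
    fix q assume "q \<in> carrier (lcc A)"
    with p show "lcc_map A B f (p \<oplus>\<^bsub>lcc A\<^esub> q) = lcc_map A B f p \<oplus>\<^bsub>lcc B\<^esub> lcc_map A B f q"
      using cl vim by (intro lcc_eqI[OF B]) (auto simp: lcc_map_apply app)
  qed
qed

text \<open>Naturality of the unit.\<close>

lemma lcc_map_hat:
  assumes A: "mv_algebra A" and B: "mv_algebra B" and f: "f \<in> mv_hom A B" and a: "a \<in> carrier A"
  shows "lcc_map A B f (mv_hat A a) = mv_hat B (f a)"
  using assms vimage_maximal(2)[OF A B f] hom_apply(1)[OF f]
  by (intro lcc_eqI[OF B] lcc_map_closed)
    (auto simp: lcc_map_apply mv_algebra.hat_lcc)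

lemma lcc_map_id:
  assumes A: "mv_algebra A"
  shows "lcc_map A A (mv_id A) = mv_id (lcc A)"
proof (rule extensionalityI[of _ "carrier (lcc A)"])
  fix p assume p: "p \<in> carrier (lcc A)"
  have "mv_id A -` N \<inter> carrier A = N" if "N \<in> MaxI A" for N
    using mv_ideal_maximal[OF that] by (auto simp: mv_id_def mv_ideal_def)
  then have "lcc_map A A (mv_id A) p = p"
    using p mv_id_hom[OF A] by (intro lcc_eqI[OF A] lcc_map_closed A) (auto simp: lcc_map_apply)
  then show "lcc_map A A (mv_id A) p = mv_id (lcc A) p"
    using p by (simp add: mv_id_def)
qed (auto simp: lcc_map_def mv_id_def)

lemma lcc_map_compose:
  assumes A: "mv_algebra A" and B: "mv_algebra B" and C: "mv_algebra C"
    and f: "f \<in> mv_hom A B" and g: "g \<in> mv_hom B C"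
  shows "lcc_map A C (compose (carrier A) g f)
    = compose (carrier (lcc A)) (lcc_map B C g) (lcc_map A B f)"
proof (rule extensionalityI[of _ "carrier (lcc A)"])
  fix p assume p: "p \<in> carrier (lcc A)"
  have "compose (carrier A) g f -` N \<inter> carrier A = f -` (g -` N \<inter> carrier B) \<inter> carrier A" for N
    using hom_apply(1)[OF f] by (auto simp: compose_def)
  then have "lcc_map A C (compose (carrier A) g f) p = lcc_map B C g (lcc_map A B f p)"
    using p f g mv_compose_hom[OF A f g] vimage_maximal(1)[OF B C g] lcc_map_closed[OF A B f p]
    by (intro lcc_eqI[OF C] lcc_map_closed A B C) (auto simp: lcc_map_apply)
  then show "lcc_map A C (compose (carrier A) g f) p
      = compose (carrier (lcc A)) (lcc_map B C g) (lcc_map A B f) p"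
    using p by (simp add: compose_def)
qed (auto simp: lcc_map_def)

text \<open>On the image of the unit, \<open>lcc_map A B f\<close> determines
  \<open>mv_hat B (f a)\<close>, and semisimplicity of \<open>B\<close> recovers \<open>f a\<close>
  from it.\<close>

lemma lcc_map_inj:
  assumes A: "mv_algebra A" and B: "semisimple B"
  shows "inj_on (lcc_map A B) (mv_hom A B)"
proof (intro inj_onI)
  fix f g assume f: "f \<in> mv_hom A B" and g: "g \<in> mv_hom A B" and eq: "lcc_map A B f = lcc_map A B g"
  show "f = g"
  proof (rule extensionalityI[of _ "carrier A"])
    fix a assume a: "a \<in> carrier A"
    have "mv_hat B (f a) = mv_hat B (g a)"
      using lcc_map_hat[OF A semisimple_mv_algebra[OF B] f a]
        lcc_map_hat[OF A semisimple_mv_algebra[OF B] g a] eq by simp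
    then show "f a = g a"
      using a hom_apply(1)[OF f] hom_apply(1)[OF g] by (intro semisimple_eqI[OF B]) auto
  qed (use f g hom_apply(5) in auto)
qed

section \<open>The adjunction\<close>

lemma lcc_adj_inj:
  assumes A: "mv_algebra A" and D: "semisimple D"
  shows "inj_on (lcc_adj A) (mv_hom (lcc A) D)"
proof (intro inj_onI)
  fix h k assume h: "h \<in> mv_hom (lcc A) D" and k: "k \<in> mv_hom (lcc A) D"
    and eq: "lcc_adj A h = lcc_adj A k"
  have hat: "h (mv_hat A a) = k (mv_hat A a)" if "a \<in> carrier A" for a
    using fun_cong[OF eq, of a] that by (simp add: lcc_adj_def compose_def)
  show "h = k"
  proof (rule extensionalityI[of _ "carrier (lcc A)"])
    fix p assume p: "p \<in> carrier (lcc A)"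
    show "h p = k p"
    proof (rule semisimple_eqI[OF D])
      show "h p \<in> carrier D" "k p \<in> carrier D"
        using p hom_apply(1)[OF h] hom_apply(1)[OF k] by auto
      fix N assume N: "N \<in> MaxI D"
      \<comment> \<open>Following \<open>h\<close> or \<open>k\<close> by the point \<open>N\<close>
        gives a valuation of \<open>lcc A\<close>, which is evaluation at the kernel of its
        restriction to \<open>A\<close>. The two restrictions agree, so the evaluations do as
        well.\<close>
      note val = mv_algebra.hat_valuation[OF semisimple_mv_algebra[OF D] N, THEN unit_valuation_compose]
      have "{a \<in> carrier A. mv_hat D (h (mv_hat A a)) N = 0}
          = {a \<in> carrier A. mv_hat D (k (mv_hat A a)) N = 0}"
        using hat by auto
      then show "mv_hat D (h p) N = mv_hat D (k p) N"
        using mv_algebra.lcc_valuation(2)[OF A val[OF h] p]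
          mv_algebra.lcc_valuation(2)[OF A val[OF k] p] by simp
    qed
  qed (use h k hom_apply(5) in auto)
qed

text \<open>The unit is invertible at complete objects: with \<open>mv_hat D\<close> as evaluation,
  every squeezed function is represented by an element of \<open>D\<close>.\<close>

lemma hat_bij_lcc:
  assumes D: "limit_cut_complete D"
  shows "bij_betw (mv_hat D) (carrier D) (carrier (lcc D))"
proof -
  have ss: "semisimple D"
    using D by (simp add: limit_cut_complete_def)
  interpret mv_algebra D
    using ss by (rule semisimple_mv_algebra)
  have "inj_on (mv_hat D) (carrier D)"
    using semisimple_eqI[OF ss] by (intro inj_onI) auto
  moreover have "p \<in> mv_hat D ` carrier D" if p: "p \<in> carrier (lcc D)" for p
  proof -
    obtain s where s: "s \<in> carrier D" "\<And>N. N \<in> MaxI D \<Longrightarrow> mv_hat D s N = p N"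
    proof (rule limit_cut_complete_represents[OF D, of "MaxI D" "mv_hat D" "carrier D" p])
      show "unit_valuation D (\<lambda>d. mv_hat D d M)" if "M \<in> MaxI D" for M
        using that by (rule hat_valuation)
      show "d \<sqsubseteq>\<^bsub>mv_order D\<^esub> e"
        if "d \<in> carrier D" "e \<in> carrier D" "\<And>M. M \<in> MaxI D \<Longrightarrow> mv_hat D d M \<le> mv_hat D e M" for d e
        using that semisimple_le_iff[OF ss] by blast
      show "\<exists>a\<in>carrier D. \<exists>b\<in>carrier D. (\<forall>y\<in>MaxI D. mv_hat D a y \<le> p y \<and> p y \<le> mv_hat D b y) \<and>
          mv_hat D b x - mv_hat D a x < \<epsilon>" if "x \<in> MaxI D" "\<epsilon> > 0" for x \<epsilon>
        using p that by (rule lccE) blast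
    qed blast+
    then have "p = mv_hat D s"
      using p hat_lcc by (intro lcc_eqI[OF mv_algebra_axioms]) auto
    then show ?thesis
      using s by blast
  qed
  ultimately show ?thesis
    using hat_lcc by (auto simp: bij_betw_def)
qed

text \<open>The extension of \<open>g\<close> is \<open>lcc_map A D g\<close> followed by the
  inverse of the unit of \<open>D\<close>. Its homomorphism laws are checked after applying the
  injective \<open>mv_hat D\<close>.\<close>

lemma lcc_adj_surj:
  assumes A: "mv_algebra A" and D: "limit_cut_complete D" and g: "g \<in> mv_hom A D"
  shows "g \<in> lcc_adj A ` mv_hom (lcc A) D"
proof -
  interpret A: mv_algebra A by (rule A)
  interpret LA: mv_algebra "lcc A"
    by (rule A.lcc_mv_algebra)
  interpret D: mv_algebra D
    using D by (simp add: limit_cut_complete_def semisimple_def)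
  note G = hom_apply[OF lcc_map_hom[OF A D.mv_algebra_axioms g]]
    and E = hom_apply[OF D.hat_hom_lcc]
  have inj: "inj_on (mv_hat D) (carrier D)" and im: "mv_hat D ` carrier D = carrier (lcc D)"
    using hat_bij_lcc[OF D] by (auto simp: bij_betw_def)
  define h where "h = (\<lambda>p\<in>carrier (lcc A). inv_into (carrier D) (mv_hat D) (lcc_map A D g p))"
  have hD: "h p \<in> carrier D" and hat_h: "mv_hat D (h p) = lcc_map A D g p" if "p \<in> carrier (lcc A)" for p
    using that G(1)[OF that] im by (simp_all add: h_def inv_into_into f_inv_into_f)
  have eqI: "d = e" if "mv_hat D d = mv_hat D e" "d \<in> carrier D" "e \<in> carrier D" for d e
    using that inj by (simp add: inj_on_def)
  have "h \<in> mv_hom (lcc A) D"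
    unfolding mv_hom_def
  proof (intro CollectI conjI ballI)
    show "h \<in> carrier (lcc A) \<rightarrow>\<^sub>E carrier D"
      using hD by (auto simp: h_def)
    show "h \<zero>\<^bsub>lcc A\<^esub> = \<zero>\<^bsub>D\<^esub>"
      by (intro eqI) (auto simp: hat_h hD G E)
    fix p assume p: "p \<in> carrier (lcc A)"
    then show "h (\<sim>\<^bsub>lcc A\<^esub> p) = \<sim>\<^bsub>D\<^esub> (h p)"
      by (intro eqI) (auto simp: hat_h hD G E)
    fix q assume "q \<in> carrier (lcc A)"
    with p show "h (p \<oplus>\<^bsub>lcc A\<^esub> q) = h p \<oplus>\<^bsub>D\<^esub> h q"
      by (intro eqI) (auto simp: hat_h hD G E)
  qed
  moreover have "g = lcc_adj A h"
  proof (rule extensionalityI[of _ "carrier A"])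
    fix a assume a: "a \<in> carrier A"
    have "g a = h (mv_hat A a)"
      using a A.hat_lcc[OF a] hom_apply(1)[OF g a] lcc_map_hat[OF A D.mv_algebra_axioms g a]
      by (intro eqI) (auto simp: hat_h hD)
    then show "g a = lcc_adj A h a"
      using a by (simp add: lcc_adj_def compose_def)
  qed (use g hom_apply(5) in \<open>auto simp: lcc_adj_def\<close>)
  ultimately show ?thesis
    by blast
qed

lemma lcc_adj_bij:
  assumes A: "mv_algebra A" and D: "limit_cut_complete D"
  shows "bij_betw (lcc_adj A) (mv_hom (lcc A) D) (mv_hom A D)"
proof -
  have "lcc_adj A h \<in> mv_hom A D" if "h \<in> mv_hom (lcc A) D" for h
    unfolding lcc_adj_def using A mv_algebra.hat_hom_lcc[OF A] that by (rule mv_compose_hom)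
  then show ?thesis
    using lcc_adj_inj[OF A] lcc_adj_surj[OF A D] D
    by (auto simp: bij_betw_def limit_cut_complete_def)
qed

text \<open>By naturality of the unit both sides send \<open>a\<close> to
  \<open>h (mv_hat B (f a))\<close>.\<close>

lemma lcc_adj_natural_left:
  assumes A: "mv_algebra A" and B: "mv_algebra B" and f: "f \<in> mv_hom A B"
  shows "lcc_adj A (compose (carrier (lcc A)) h (lcc_map A B f)) = compose (carrier A) (lcc_adj B h) f"
  unfolding lcc_adj_def compose_def
  using hom_apply(1)[OF f] mv_algebra.hat_lcc[OF A] lcc_map_hat[OF A B f]
  by (intro restrict_ext) simp

lemma lcc_adj_natural_right:
  assumes A: "mv_algebra A"
  shows "lcc_adj A (compose (carrier (lcc A)) k h) = compose (carrier A) k (lcc_adj A h)"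
  using mv_algebra.hat_lcc[OF A] by (auto simp: lcc_adj_def compose_def restrict_def fun_eq_iff)

theorem theorem5p7:
  shows
    \<comment> \<open>object assignment\<close>
    "(\<forall>A \<in> (MVss :: 'a mv set). lcc A \<in> MVlcc) \<and>
    \<comment> \<open>morphism assignment, identities and composites\<close>
     (\<forall>A \<in> (MVss :: 'a mv set). \<forall>B \<in> (MVss :: 'b mv set). \<forall>f \<in> mv_hom A B.
        lcc_map A B f \<in> mv_hom (lcc A) (lcc B)) \<and>
     (\<forall>A \<in> (MVss :: 'a mv set). lcc_map A A (mv_id A) = mv_id (lcc A)) \<and>
     (\<forall>A \<in> (MVss :: 'a mv set). \<forall>B \<in> (MVss :: 'b mv set). \<forall>C \<in> (MVss :: 'c mv set).
        \<forall>f \<in> mv_hom A B. \<forall>g \<in> mv_hom B C.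
          lcc_map A C (compose (carrier A) g f)
            = compose (carrier (lcc A)) (lcc_map B C g) (lcc_map A B f)) \<and>
    \<comment> \<open>faithfulness\<close>
     (\<forall>A \<in> (MVss :: 'a mv set). \<forall>B \<in> (MVss :: 'b mv set).
        inj_on (lcc_map A B) (mv_hom A B)) \<and>
    \<comment> \<open>left adjoint to the inclusion: bijection of hom-sets, natural in both arguments\<close>
     (\<forall>A \<in> (MVss :: 'a mv set). \<forall>D \<in> (MVlcc :: 'd mv set).
        bij_betw (lcc_adj A) (mv_hom (lcc A) D) (mv_hom A D)) \<and>
     (\<forall>A \<in> (MVss :: 'a mv set). \<forall>B \<in> (MVss :: 'b mv set). \<forall>D \<in> (MVlcc :: 'd mv set).
        \<forall>f \<in> mv_hom A B. \<forall>h \<in> mv_hom (lcc B) D.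
          lcc_adj A (compose (carrier (lcc A)) h (lcc_map A B f))
            = compose (carrier A) (lcc_adj B h) f) \<and>
     (\<forall>A \<in> (MVss :: 'a mv set). \<forall>D \<in> (MVlcc :: 'd mv set). \<forall>E \<in> (MVlcc :: 'e mv set).
        \<forall>h \<in> mv_hom (lcc A) D. \<forall>k \<in> mv_hom D E.
          lcc_adj A (compose (carrier (lcc A)) k h) = compose (carrier A) k (lcc_adj A h))"
  by (auto simp: MVss_def MVlcc_def semisimple_mv_algebra mv_algebra.lcc_limit_cut_complete
      lcc_map_hom lcc_map_id lcc_map_compose lcc_map_inj lcc_adj_bij
      intro!: lcc_adj_natural_left lcc_adj_natural_right)

end
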